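(* Let $p$ be an odd prime and let $\gamma=\begin{pmatrix} a & b\\ c& d\end{pmatrix}\in\Gamma_0^+(p)$. Then $$\Phi_p(\gamma)=\begin{cases}\dfrac{\tau_\alpha+\tau_\beta}{2}-3\left(\dfrac{\sigma_\alpha+\sigma_\beta}{2}\right) & \text{if }\gamma\in\Gamma_0(p),\\[3mm] \Phi_p\left(\dfrac{1}{\sqrt p}\begin{pmatrix} c & d\\ -pa & -pb\end{pmatrix}\right)-3\operatorname{sgn}(-ac) & \text{if }\gamma\notin\Gamma_0(p).\end{cases}$$ Here, for $\gamma\in\Gamma_0(p)$, $\alpha=(a_1,\dots,a_k)$ and $\beta=(b_1,\dots,b_m)$ are two based edge paths (finite lists of integers) made from $\gamma$ and $\begin{pmatrix} a & pb\\ c/p & d\end{pmatrix}\in \mathrm{SL}_2(\mathbb Z)$, i.e. such that in $\mathrm{PSL}_2(\mathbb Z)$ $$\begin{pmatrix} a & b\\ c& d\end{pmatrix}=S(T^{a_1}S)\cdots(T^{a_k}S),\qquad \begin{pmatrix} a & pb\\ c/p & d\end{pmatrix}=S(T^{b_1}S)\cdots(T^{b_m}S),$$ where $S=\begin{pmatrix}0&-1\\1&0\end{pmatrix}$, $T=\begin{pmatrix}1&1\\0&1\end{pmatrix}$; $\tau_\alpha,\sigma_\alpha$ are the trace and signature of the symmetric tridiagonal $k\times k$ matrix $M_\alpha$ whose $(i,j)$ entry is $a_i$ if $i=j$, $1$ if $|i-j|=1$, and $0$ otherwise; and $\tau_\beta,\sigma_\beta$ are the trace and signature of the symmetric tridiagonal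 $m\times m$ matrix $M_\beta$ whose $(i,j)$ entry is $b_i$ if $i=j$, $1$ if $|i-j|=1$, and $0$ otherwise.
   Context: Notation. $\operatorname{sgn}$ is the sign function with $\operatorname{sgn}(0):=0$. The signature of a real symmetric matrix is the number of positive eigenvalues minus the number of negative eigenvalues (with multiplicity). Groups: $\Gamma_0(p)=\left\{\begin{pmatrix} a & b\\ c& d\end{pmatrix}\in \mathrm{SL}_2(\mathbb Z): c\equiv 0 \pmod p\right\}$, and $\Gamma_0^+(p)$ is the normalizer of $\Gamma_0(p)$ in $\mathrm{SL}_2(\mathbb R)$; it is generated by $\Gamma_0(p)$ and $W_p=\frac{1}{\sqrt p}\begin{pmatrix}0&-1\\ p&0\end{pmatrix}$. Dedekind sums: for coprime integers $h,k$ with $k\geq 1$, $s(h,k)=\sum_{\mu=1}^k \left(\!\left(\frac{h\mu}{k}\right)\!\right)\left(\!\left(\frac{\mu}{k}\right)\!\right)$, where $((x))=x-\lfloor x\rfloor-\frac12$ if $x\notin\mathbb Z$ and $((x))=0$ if $x\in\mathbb Z$. Rademacher symbol: for $\gamma=\begin{pmatrix} a & b\\ c& d\end{pmatrix}\in \mathrm{SL}_2(\mathbb Z)$, $\Phi(\gamma)=\frac bd$ if $c=0$, and $\Phi(\gamma)=\frac{a+d}{c}-12\operatorname{sgn}(c)\,s(d,|c|)$ if $c\neq0$. Rademacher symbol for $\Gamma_0^+(p)$: for $\gamma=\begin{pmatrix} a & b\\ c& d\end{pmatrix}\in\Gamma_0(p)$, $\Phi_p(\gamma):=\frac12\left[\Phi(\gamma)+\Phi\left(\begin{pmatrix}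 a & pb\\ c/p & d\end{pmatrix}\right)\right]$; for $\gamma\in\Gamma_0^+(p)\setminus\Gamma_0(p)$, $\Phi_p(\gamma):=\Phi_p\left(\frac{1}{\sqrt p}\begin{pmatrix} c & d\\ -pa & -pb\end{pmatrix}\right)-3\operatorname{sgn}(-ac)$, where the matrix in the argument lies in $\Gamma_0(p)$. Based edge paths: $K$ is the triangulation of the upper half-plane by ideal triangles obtained by successive reflections of the ideal triangle with vertices $0,1,\infty$; its vertices are $\mathbb Q\cup\{\infty\}$ (with $\infty=\frac{1}{0}=\frac{-1}{0}$), and $\frac{n_1}{d_1},\frac{n_2}{d_2}$ in lowest terms are joined by an edge iff $n_1d_2-n_2d_1=\pm1$. A based edge path in $K$ is a path of directed edges $E_0,E_1,\dots,E_k$ starting with $E_0$ from $\infty$ to $0$, each edge starting where the previous one ends. It is encoded by a list of integers $(a_1,\dots,a_k)$: the edge $E_j$ goes from $\frac{b_j'}{d_j'}$ to $\frac{a_j'}{c_j'}$, where $\begin{pmatrix} a_j' & b_j'\\ c_j'& d_j'\end{pmatrix}=S(T^{a_1}S)\cdots(T^{a_j}S)$ in $\mathrm{PSL}_2(\mathbb Z)$. *)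

theory Defs
  imports
    "HOL-Analysis.Determinants"
    "HOL-Algebra.Group_Action"
    "HOL-Computational_Algebra.Primes"
    "Jordan_Normal_Form.Char_Poly"
begin

text \<open>
  Two-by-two matrices are elements of \<open>'a^2^2\<close>; the tridiagonal matrices, whose size is the
  length of a list, are matrices of type \<open>'a Matrix.mat\<close>.
\<close>

no_notation vec_index (infixl "$" 100)
hide_const (open) Matrix.vec Determinant.det Coset.order Congruence.partition


section \<open>The groups\<close>

definition mat2 :: "'a::zero \<Rightarrow> 'a \<Rightarrow> 'a \<Rightarrow> 'a \<Rightarrow> 'a^2^2" where
  "mat2 a b c d = vector [vector [a, b], vector [c, d]]"

lemma mat2_nth [simp]:
  "mat2 a b c d $ 1 $ 1 = a" "mat2 a b c d $ 1 $ 2 = b"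
  "mat2 a b c d $ 2 $ 1 = c" "mat2 a b c d $ 2 $ 2 = d"
  by (simp_all add: mat2_def)

definition SL2 :: "('a::comm_ring_1^2^2) monoid" where
  "SL2 = \<lparr>carrier = {A. Determinants.det A = 1}, mult = (**), one = Finite_Cartesian_Product.mat 1\<rparr>"

abbreviation real_mat :: "int^2^2 \<Rightarrow> real^2^2" where
  "real_mat \<equiv> map_matrix real_of_int"

text \<open>On integral real matrices this is the inverse of \<^const>\<open>real_mat\<close>.\<close>
abbreviation int_mat :: "real^2^2 \<Rightarrow> int^2^2" where
  "int_mat \<equiv> map_matrix floor"

definition Gamma0 :: "nat \<Rightarrow> (real^2^2) set" where
  "Gamma0 p = real_mat ` {A \<in> carrier SL2. int p dvd A $ 2 $ 1}"

definition Gamma0_plus :: "nat \<Rightarrow> (real^2^2) set" where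
  "Gamma0_plus p = normalizer SL2 (Gamma0 p)"

text \<open>Equality in $\mathrm{PSL}_2 = \mathrm{SL}_2/\{\pm 1\}$ of the classes of two matrices.\<close>
definition PSL2_eq :: "'a::ring_1^2^2 \<Rightarrow> 'a^2^2 \<Rightarrow> bool" where
  "PSL2_eq A B \<longleftrightarrow> A = B \<or> A = - B"


section \<open>Rademacher symbols\<close>

definition sawtooth :: "real \<Rightarrow> real" where
  "sawtooth x = (if x \<in> \<int> then 0 else x - of_int \<lfloor>x\<rfloor> - 1 / 2)"

definition dedekind_sum :: "int \<Rightarrow> int \<Rightarrow> real" where
  "dedekind_sum h k =
     (\<Sum>\<mu> = 1..k. sawtooth (of_int (h * \<mu>) / of_int k) * sawtooth (of_int \<mu> / of_int k))"

definition rademacher :: "int^2^2 \<Rightarrow> real" where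
  "rademacher A =
     (let a = A $ 1 $ 1; b = A $ 1 $ 2; c = A $ 2 $ 1; d = A $ 2 $ 2 in
      if c = 0 then of_int b / of_int d
      else of_int (a + d) / of_int c - 12 * of_int (sgn c) * dedekind_sum d \<bar>c\<bar>)"

text \<open>The matrix with rows $(a, pb)$ and $(c/p, d)$.\<close>
definition level_conj :: "nat \<Rightarrow> real^2^2 \<Rightarrow> real^2^2" where
  "level_conj p A = mat2 (A $ 1 $ 1) (of_nat p * A $ 1 $ 2) (A $ 2 $ 1 / of_nat p) (A $ 2 $ 2)"

text \<open>The matrix $\frac{1}{\sqrt p}$ times the matrix with rows $(c, d)$ and $(-pa, -pb)$.\<close>
definition fricke :: "nat \<Rightarrow> real^2^2 \<Rightarrow> real^2^2" where
  "fricke p A = (1 / sqrt (of_nat p)) *\<^sub>R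
     mat2 (A $ 2 $ 1) (A $ 2 $ 2) (- of_nat p * A $ 1 $ 1) (- of_nat p * A $ 1 $ 2)"

definition rademacher_Gamma0 :: "nat \<Rightarrow> real^2^2 \<Rightarrow> real" where
  "rademacher_Gamma0 p A =
     (rademacher (int_mat A) + rademacher (int_mat (level_conj p A))) / 2"

text \<open>
  Meaningful on \<^term>\<open>Gamma0_plus p\<close> only; there, outside \<^term>\<open>Gamma0 p\<close>, the matrix
  \<^term>\<open>fricke p A\<close> lies in \<^term>\<open>Gamma0 p\<close> if \<open>p\<close> is prime.
\<close>
definition rademacher_plus :: "nat \<Rightarrow> real^2^2 \<Rightarrow> real" where
  "rademacher_plus p A =
     (if A \<in> Gamma0 p then rademacher_Gamma0 p A
      else rademacher_Gamma0 p (fricke p A) - 3 * sgn (- (A $ 1 $ 1 * A $ 2 $ 1)))"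


section \<open>Based edge paths\<close>

definition S_mat :: "int^2^2" where "S_mat = mat2 0 (-1) 1 0"

definition T_mat :: "int^2^2" where "T_mat = mat2 1 1 0 1"

text \<open>
  A based edge path is given by its list of integers. For $j \le k$ the columns of the path matrix
  of the first $j$ integers are the terminal and the initial vertex of the edge $E_j$.
\<close>
definition path_matrix :: "int list \<Rightarrow> int^2^2" where
  "path_matrix \<alpha> = foldl (\<lambda>A a. A ** ((T_mat [^]\<^bsub>SL2\<^esub> a) ** S_mat)) S_mat \<alpha>"

definition path_tridiag :: "int list \<Rightarrow> real Matrix.mat" where
  "path_tridiag \<alpha> = Matrix.mat (length \<alpha>) (length \<alpha>)
     (\<lambda>(i, j). if i = j then of_int (\<alpha> ! i) else if i = j + 1 \<or> j = i + 1 then 1 else 0)"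

definition mat_trace :: "'a::comm_monoid_add Matrix.mat \<Rightarrow> 'a" where
  "mat_trace M = (\<Sum>i < dim_row M. M $$ (i, i))"

text \<open>
  Multiplicities are algebraic; for real symmetric matrices these are also the geometric ones.
\<close>
definition signature :: "real Matrix.mat \<Rightarrow> int" where
  "signature M =
     (\<Sum>x | eigenvalue M x \<and> x > 0. int (Polynomial.order x (char_poly M)))
   - (\<Sum>x | eigenvalue M x \<and> x < 0. int (Polynomial.order x (char_poly M)))"


section \<open>Basic facts\<close>

lemma mat2_eqI:
  fixes A B :: "'a^2^2"
  assumes "A$1$1 = B$1$1" "A$1$2 = B$1$2" "A$2$1 = B$2$1" "A$2$2 = B$2$2"
  shows "A = B"
  using assms by (simp add: Finite_Cartesian_Product.vec_eq_iff forall_2)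

lemma mat2_mult:
  fixes a :: "'a::comm_ring_1"
  shows "mat2 a b c d ** mat2 a' b' c' d' =
    mat2 (a * a' + b * c') (a * b' + b * d') (c * a' + d * c') (c * b' + d * d')"
  by (rule mat2_eqI) (simp_all add: matrix_matrix_mult_def sum_2)

lemma mat2_uminus: "- mat2 a b c d = mat2 (-a) (-b) (-c) (-d :: 'a::ring_1)"
  by (rule mat2_eqI) simp_all

lemma mat2_cases:
  obtains a b c d :: "'a::zero" where "A = mat2 a b c d"
proof
  show "A = mat2 (A$1$1) (A$1$2) (A$2$1) (A$2$2)" by (rule mat2_eqI) simp_all
qed

lemma mat2_one: "Finite_Cartesian_Product.mat 1 = mat2 1 0 0 (1 :: 'a::comm_ring_1)"
  by (rule mat2_eqI) (simp_all add: Finite_Cartesian_Product.mat_def)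

lemma mat2_in_SL2 [simp]:
  "mat2 a b c d \<in> carrier SL2 \<longleftrightarrow> a * d - b * c = (1 :: 'a::comm_ring_1)"
  by (simp add: SL2_def det_2)

lemma group_SL2: "group (SL2 :: ('a::comm_ring_1^2^2) monoid)"
proof (rule groupI)
  fix x :: "'a^2^2" assume x: "x \<in> carrier SL2"
  obtain a b c d where [simp]: "x = mat2 a b c d" by (rule mat2_cases)
  have "mat2 d (-b) (-c) a \<in> carrier SL2" "mat2 d (-b) (-c) a \<otimes>\<^bsub>SL2\<^esub> x = \<one>\<^bsub>SL2\<^esub>"
    using x by (simp_all add: mult.commute, simp add: SL2_def mat2_mult mat2_one algebra_simps)
  then show "\<exists>y\<in>carrier SL2. y \<otimes>\<^bsub>SL2\<^esub> x = \<one>\<^bsub>SL2\<^esub>" by blast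
qed (auto simp: SL2_def Determinants.det_mul matrix_mul_assoc)

lemma T_mat_int_pow: "T_mat [^]\<^bsub>SL2\<^esub> (n :: int) = mat2 1 n 0 1"
proof -
  interpret group "SL2 :: (int^2^2) monoid" by (rule group_SL2)
  have nat: "T_mat [^]\<^bsub>SL2\<^esub> (m :: nat) = mat2 1 (int m) 0 1" for m
    by (induction m) (simp_all add: SL2_def T_mat_def mat2_mult mat2_one)
  have T: "T_mat \<in> carrier SL2" by (simp add: T_mat_def)
  have inv: "inv\<^bsub>SL2\<^esub> (mat2 1 m 0 1) = mat2 1 (-m) 0 (1::int)" for m
    by (rule inv_equality) (simp_all, simp add: SL2_def mat2_mult mat2_one)
  show ?thesis
    by (cases n rule: int_cases2) (simp_all add: int_pow_int nat int_pow_neg[OF T] inv)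
qed

lemma path_matrix_snoc:
  "path_matrix (\<alpha> @ [n]) = path_matrix \<alpha> ** mat2 n (-1) 1 0"
  by (simp add: path_matrix_def T_mat_int_pow S_mat_def mat2_mult)

text \<open>Every element of $\mathrm{PSL}_2(\mathbb Z)$ is the matrix of some based edge path.\<close>
lemma ex_path_matrix:
  assumes "A \<in> carrier SL2"
  shows "\<exists>\<alpha>. PSL2_eq A (path_matrix \<alpha>)"
  using assms
proof (induction "nat \<bar>A$2$2\<bar>" arbitrary: A rule: less_induct)
  case less
  obtain a b c d where A: "A = mat2 a b c d" by (rule mat2_cases)
  have det: "a * d - b * c = 1" using less.prems by (simp add: A)
  show ?case
  proof (cases "d = 0")
    case True
    have "b = 1 \<and> c = -1 \<or> b = -1 \<and> c = 1"
      using det True by (auto simp: minus_equation_iff zmult_eq_1_iff dest: arg_cong[where f = uminus])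
        (metis minus_mult_right zmult_eq_1_iff minus_minus mult_minus_right)+
    moreover have "path_matrix [0, n] = mat2 (-n) 1 (-1) 0" for n
      by (simp add: path_matrix_def T_mat_int_pow S_mat_def mat2_mult)
    ultimately have "PSL2_eq A (path_matrix [0, if c = 1 then a else -a])"
      by (auto simp: PSL2_eq_def A True mat2_uminus)
    then show ?thesis by blast
  next
    case False
    define n where "n = - (c div d)"
    define B where "B = mat2 (-b) (a + n * b) (-d) (c + n * d)"
    have "c + n * d = c mod d" by (simp add: n_def minus_div_mult_eq_mod)
    then have "\<bar>c + n * d\<bar> < \<bar>d\<bar>" using False by (simp add: abs_mod_less)
    then have "nat \<bar>B$2$2\<bar> < nat \<bar>A$2$2\<bar>" by (simp add: A B_def)
    moreover have "B \<in> carrier SL2" using det by (simp add: B_def algebra_simps)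
    ultimately obtain \<alpha> where "PSL2_eq B (path_matrix \<alpha>)" using less.hyps by blast
    moreover have "A = B ** mat2 n (-1) 1 0" "A = - ((- B) ** mat2 n (-1) 1 0)"
      by (simp_all add: A B_def mat2_mult mat2_uminus)
    ultimately have "PSL2_eq A (path_matrix (\<alpha> @ [n]))"
      by (auto simp: PSL2_eq_def path_matrix_snoc)
    then show ?thesis by blast
  qed
qed

end

theory Submission
  imports Defs
begin

text \<open>
  The symbol $\Phi_p$ of an element of $\Gamma_0(p)$ is the mean of two classical Rademacher symbols,
  so on $\Gamma_0(p)$ everything rests on the identity
  $\Phi(A) = \mathrm{tr}\, M_\alpha - 3\, \mathrm{sign}\, M_\alpha$ for every edge path $\alpha$ with matrix
  $\pm A$ (\<open>rademacher_path_matrix\<close>). It is proved by induction on the list $\alpha$,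
  comparing both sides when an integer $n$ is put in front. Then $A$ becomes $S T^n A$, the lower
  left entry of the matrix runs through the continuants of the list, and these are the determinants
  of the tridiagonal matrices. Let $c$ and $c'$ be the determinants before and after the step.

  On the arithmetic side, $T^n$ on the left adds $n$ to $\Phi$, and $S$ on the left adds
  $-3\,\mathrm{sgn}(c c')$ (\<open>rademacher_S_mult\<close>). The second fact is the reciprocity law for Dedekind sums
  (\<open>dedekind_reciprocity\<close>), rewritten with the help of $s(h,k) = s(h^{-1},k)$.

  On the linear side the trace grows by $n$, and the signature by
  $\mathrm{sgn}(c c')$ (\<open>signature_path_tridiag_Cons\<close>). The characteristic polynomials form a Sturm
  sequence: the Wronskian of two consecutive ones is positive on the real line, and none of them
  has a zero off the real line. Hence the eigenvalues are real, simple, and those of the old matrix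
  separate those of the new one. The numbers of positive and of negative eigenvalues then change by at most one each,
  and the sign of $c c'$ tells by parity which of the two changes.

  Outside $\Gamma_0(p)$ the asserted formula is the definition of $\Phi_p$, provided that
  the Fricke translate of $\gamma$ lies in $\Gamma_0(p)$. This is the description of the normalizer of $\Gamma_0(p)$
  (\<open>Gamma0_plus_cases\<close>): conjugating three explicit elements shows that all products of entries of $\gamma$
  are integral up to factors $p$, so $\gamma$ is a primitive integral matrix divided by the root of its
  determinant, and the integrality leaves only the determinants $1$ and $p$.
\<close>

section \<open>Dedekind sums\<close>

lemma sawtooth_of_int_add [simp]: "sawtooth (x + of_int n) = sawtooth x"
  by (simp add: sawtooth_def)

lemma sawtooth_minus: "sawtooth (- x) = - sawtooth x"
proof (cases "x \<in> \<int>")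
  case False
  then have "\<lceil>x\<rceil> = \<lfloor>x\<rfloor> + 1" by (metis Ints_of_int ceiling_altdef)
  then show ?thesis using False by (simp add: sawtooth_def ceiling_def)
qed (simp add: sawtooth_def)

lemma sawtooth_of_int [simp]: "sawtooth (of_int n) = 0"
  by (simp add: sawtooth_def)

lemma sawtooth_divide_mod:
  assumes "k > 0"
  shows "sawtooth (of_int (m mod k) / of_int k) = sawtooth (of_int m / of_int k)"
proof -
  have "real_of_int m = of_int (m mod k) + of_int k * of_int (m div k)"
    by (metis add.commute mult_div_mod_eq of_int_add of_int_mult)
  then have "real_of_int m / of_int k = of_int (m mod k) / of_int k + of_int (m div k)"
    using assms by (simp add: field_simps)
  then show ?thesis by simp
qed

lemma sawtooth_divide_cong:
  assumes "k > 0" "m mod k = n mod k"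
  shows "sawtooth (of_int m / of_int k) = sawtooth (of_int n / of_int k)"
  by (metis assms sawtooth_divide_mod)

lemma dedekind_sum_altdef:
  assumes "k > 0"
  shows "dedekind_sum h k =
    (\<Sum>\<mu>\<in>{0..<k}. sawtooth (of_int (h * \<mu>) / of_int k) * sawtooth (of_int \<mu> / of_int k))"
proof -
  let ?f = "\<lambda>\<mu>. sawtooth (of_int (h * \<mu>) / of_int k) * sawtooth (of_int \<mu> / of_int k)"
  have "{1..k} = insert k {1..<k}" "{0..<k} = insert 0 {1..<k}" using assms by auto
  moreover have "?f k = 0" "?f 0 = 0" using assms sawtooth_of_int[of 1] sawtooth_of_int[of 0] by simp_all
  ultimately show ?thesis unfolding dedekind_sum_def by simp
qed

lemma bij_betw_mult_mod:
  fixes h k :: int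
  assumes "coprime h k" "k > 0"
  shows "bij_betw (\<lambda>\<mu>. (h * \<mu>) mod k) {0..<k} {0..<k}"
proof -
  have inj: "inj_on (\<lambda>\<mu>. (h * \<mu>) mod k) {0..<k}"
  proof (rule inj_onI)
    fix x y assume xy: "x \<in> {0..<k}" "y \<in> {0..<k}" "(h * x) mod k = (h * y) mod k"
    then have "k dvd h * (x - y)" by (simp add: mod_eq_dvd_iff right_diff_distrib)
    then have "k dvd x - y" using assms by (simp add: coprime_dvd_mult_right_iff coprime_commute)
    then have "x mod k = y mod k" by (simp add: mod_eq_dvd_iff)
    then show "x = y" using xy by simp
  qed
  moreover have "(\<lambda>\<mu>. (h * \<mu>) mod k) ` {0..<k} \<subseteq> {0..<k}" using assms by auto
  ultimately show ?thesis using endo_inj_surj[of "{0..<k}"] by (auto simp: bij_betw_def)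
qed

lemma dedekind_sum_minus: "dedekind_sum (- h) k = - dedekind_sum h k"
proof -
  have "sawtooth (of_int (- h * \<mu>) / of_int k) = - sawtooth (of_int (h * \<mu>) / of_int k)" for \<mu>
    by (subst sawtooth_minus[symmetric]) simp
  then show ?thesis unfolding dedekind_sum_def by (simp add: sum_negf)
qed

text \<open>
  Substituting $\mu \mapsto h' \mu$ in the sum over residues modulo $k$ moves the multiplier
  from one sawtooth factor to the other.
\<close>
lemma dedekind_sum_inverse:
  assumes k: "k > 0" and inv: "h * h' mod k = 1 mod k"
  shows "dedekind_sum h k = dedekind_sum h' k"
proof -
  let ?s = "\<lambda>m. sawtooth (of_int m / of_int k)"
  have cop: "coprime h' k"
  proof (rule coprimeI)
    fix c assume "c dvd h'" "c dvd k"
    moreover have "k dvd h * h' - 1" using inv by (simp add: mod_eq_dvd_iff)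
    ultimately show "is_unit c"
      by (metis dvd_diffD1 dvd_mult dvd_trans dvd_diff diff_diff_cancel dvd_mult2 diff_add_cancel dvd_add_right_iff)
  qed
  have "dedekind_sum h k = (\<Sum>\<mu>\<in>{0..<k}. ?s (h * (h' * \<mu> mod k)) * ?s (h' * \<mu> mod k))"
    unfolding dedekind_sum_altdef[OF k]
    by (rule sum.reindex_bij_betw[OF bij_betw_mult_mod[OF cop k], symmetric])
  also have "\<dots> = (\<Sum>\<mu>\<in>{0..<k}. ?s (h' * \<mu>) * ?s \<mu>)"
  proof (rule sum.cong[OF refl])
    fix \<mu>
    have "h * (h' * \<mu> mod k) mod k = (h * h') * \<mu> mod k" by (simp add: mod_mult_right_eq mult.assoc)
    also have "\<dots> = \<mu> mod k" using inv by (metis mod_mult_left_eq mult_1)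
    finally have "?s (h * (h' * \<mu> mod k)) = ?s \<mu>" by (rule sawtooth_divide_cong[OF k])
    then show "?s (h * (h' * \<mu> mod k)) * ?s (h' * \<mu> mod k) = ?s (h' * \<mu>) * ?s \<mu>"
      using sawtooth_divide_mod[OF k, of "h' * \<mu>"] by simp
  qed
  finally show ?thesis by (simp add: dedekind_sum_altdef[OF k])
qed

lemma dedekind_sum_1_right [simp]: "dedekind_sum h 1 = 0"
proof -
  have "sawtooth (real_of_int h) = 0" by simp
  then show ?thesis by (simp add: dedekind_sum_def)
qed

lemma sum_int_upto: "0 \<le> n \<Longrightarrow> (\<Sum>i = 1..n. real_of_int i) = n * (n + 1) / 2"
proof (induction n rule: int_ge_induct)
  case (step n)
  have "{1..n+1} = insert (n + 1) {1..n}" using step by auto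
  then show ?case using step by (simp add: field_simps)
qed simp

lemma sum_square_int_upto: "0 \<le> n \<Longrightarrow> (\<Sum>i = 1..n. (real_of_int i)\<^sup>2) = n * (n + 1) * (2 * n + 1) / 6"
proof (induction n rule: int_ge_induct)
  case (step n)
  have "{1..n+1} = insert (n + 1) {1..n}" using step by auto
  then show ?case using step by (simp add: field_simps power2_eq_square)
qed simp

lemma int_le_div_iff: "0 < k \<Longrightarrow> m \<le> a div k \<longleftrightarrow> m * k \<le> (a::int)"
proof -
  assume k: "0 < k"
  have "m \<le> a div k \<longleftrightarrow> m \<le> \<lfloor>real_of_int a / of_int k\<rfloor>" by (simp add: floor_divide_of_int_eq)
  also have "\<dots> \<longleftrightarrow> real_of_int (m * k) \<le> of_int a"
    using k by (simp add: le_floor_iff pos_le_divide_eq)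
  finally show ?thesis by (simp only: of_int_le_iff)
qed

lemma sawtooth_divide_not_dvd:
  assumes "k > 0" "\<not> k dvd m"
  shows "sawtooth (of_int m / of_int k) = of_int m / of_int k - of_int (m div k) - 1 / 2"
proof -
  have "real_of_int m / of_int k \<notin> \<int>"
  proof
    assume "real_of_int m / of_int k \<in> \<int>"
    then obtain n where "real_of_int m / of_int k = of_int n" by (rule Ints_cases)
    then have "real_of_int m = of_int (n * k)" using assms by (simp add: field_simps)
    then show False using assms by (simp only: of_int_eq_iff) simp
  qed
  then show ?thesis by (simp add: sawtooth_def floor_divide_of_int_eq)
qed

context
  fixes h k :: int
  assumes cop: "coprime h k" and k: "k > 0"
begin

lemma sawtooth_mult_divide:
  assumes "\<mu> \<in> {1..k-1}"
  shows "sawtooth (of_int (h * \<mu>) / of_int k) = of_int h * of_int \<mu> / of_int k - of_int (h * \<mu> div k) - 1 / 2"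
proof -
  have "\<not> k dvd \<mu>" using assms zdvd_not_zless by auto
  then have "\<not> k dvd h * \<mu>" using cop by (simp add: coprime_dvd_mult_right_iff coprime_commute)
  from sawtooth_divide_not_dvd[OF k this] show ?thesis by simp
qed

lemma sawtooth_divide:
  assumes "\<mu> \<in> {1..k-1}"
  shows "sawtooth (of_int \<mu> / of_int k) = of_int \<mu> / of_int k - 1 / 2"
proof -
  have "\<not> k dvd \<mu>" using assms zdvd_not_zless by auto
  from sawtooth_divide_not_dvd[OF k this] show ?thesis using assms by (simp add: div_pos_pos_trivial)
qed

text \<open>
  Multiplication by $h$ permutes the nonzero residues modulo $k$, so symmetric sums of sawtooth
  values do not see the multiplier. It is used for the sum of the values, which vanishes, and
  for the sum of their squares, where it is the source of the reciprocity law.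
\<close>
lemma sum_sawtooth_permute:
  fixes f :: "real \<Rightarrow> real"
  assumes "f 0 = 0"
  shows "(\<Sum>\<mu> = 1..k-1. f (sawtooth (of_int (h * \<mu>) / of_int k))) = (\<Sum>\<mu> = 1..k-1. f (sawtooth (of_int \<mu> / of_int k)))"
proof -
  have *: "(\<Sum>\<mu> = 1..k-1. g \<mu>) = (\<Sum>\<mu>\<in>{0..<k}. g \<mu>)" if "g 0 = 0" for g :: "int \<Rightarrow> real"
  proof -
    have "{0..<k} = insert 0 {1..k-1}" using k by auto
    then show ?thesis using that by simp
  qed
  have "(\<Sum>\<mu>\<in>{0..<k}. f (sawtooth (of_int \<mu> / of_int k)))
      = (\<Sum>\<mu>\<in>{0..<k}. f (sawtooth (of_int (h * \<mu> mod k) / of_int k)))"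
    by (rule sum.reindex_bij_betw[OF bij_betw_mult_mod[OF cop k], symmetric])
  then show ?thesis
    using assms sawtooth_of_int[of 0] by (simp add: * sawtooth_divide_mod[OF k])
qed

lemma sum_linear: "(\<Sum>\<mu> = 1..k-1. real_of_int \<mu>) = (k - 1) * k / 2"
  and sum_square: "(\<Sum>\<mu> = 1..k-1. (real_of_int \<mu>)\<^sup>2) = (k - 1) * k * (2 * k - 1) / 6"
  using sum_int_upto[of "k-1"] sum_square_int_upto[of "k-1"] k by (simp_all add: algebra_simps)

text \<open>
  Since the sawtooth values at $h\mu/k$ add up to zero, the second factor $\mu/k - \frac12$ may
  be replaced by $\mu/k$. What remains is linear in the floors.
\<close>
lemma dedekind_sum_floor:
  "of_int k * dedekind_sum h k = of_int h * (k - 1) * (2 * k - 1) / 6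
     - (\<Sum>\<mu> = 1..k-1. of_int \<mu> * of_int (h * \<mu> div k)) - of_int k * (k - 1) / 4"
proof -
  let ?s = "\<lambda>\<mu>. sawtooth (of_int (h * \<mu>) / of_int k)"
  have "(\<Sum>\<mu> = 1..k-1. ?s \<mu>) = (\<Sum>\<mu> = 1..k-1. sawtooth (of_int \<mu> / of_int k))"
    using sum_sawtooth_permute[of "\<lambda>x. x"] by simp
  also have "\<dots> = (\<Sum>\<mu> = 1..k-1. of_int \<mu> / of_int k - 1 / 2)"
    by (intro sum.cong refl sawtooth_divide)
  also have "\<dots> = 0" using k by (simp add: sum_subtractf sum_divide_distrib[symmetric] sum_linear)
  finally have zero: "(\<Sum>\<mu> = 1..k-1. ?s \<mu>) = 0" .
  have "dedekind_sum h k = (\<Sum>\<mu> = 1..k-1. ?s \<mu> * sawtooth (of_int \<mu> / of_int k))"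
  proof -
    have "{1..k} = insert k {1..k-1}" using k by auto
    then show ?thesis using k sawtooth_of_int[of 1] by (simp add: dedekind_sum_def)
  qed
  also have "\<dots> = (\<Sum>\<mu> = 1..k-1. ?s \<mu> * of_int \<mu> / of_int k - ?s \<mu> / 2)"
    by (intro sum.cong refl) (simp add: sawtooth_divide algebra_simps)
  also have "\<dots> = (\<Sum>\<mu> = 1..k-1. ?s \<mu> * of_int \<mu> / of_int k)"
    using zero by (simp add: sum_subtractf sum_divide_distrib[symmetric])
  finally have "of_int k * dedekind_sum h k = (\<Sum>\<mu> = 1..k-1. ?s \<mu> * of_int \<mu>)"
    using k by (simp add: sum_divide_distrib[symmetric])
  also have "\<dots> = (\<Sum>\<mu> = 1..k-1. of_int h / of_int k * (of_int \<mu>)\<^sup>2 - of_int \<mu> * of_int (h * \<mu> div k) - 1 / 2 * of_int \<mu>)"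
  proof (rule sum.cong[OF refl])
    fix \<mu> assume "\<mu> \<in> {1..k-1}"
    then show "?s \<mu> * of_int \<mu> = of_int h / of_int k * (of_int \<mu>)\<^sup>2 - of_int \<mu> * of_int (h * \<mu> div k) - 1 / 2 * of_int \<mu>"
      by (simp only: sawtooth_mult_divide) (simp add: algebra_simps power2_eq_square)
  qed
  also have "\<dots> = of_int h / of_int k * (\<Sum>\<mu> = 1..k-1. (of_int \<mu>)\<^sup>2) - (\<Sum>\<mu> = 1..k-1. of_int \<mu> * of_int (h * \<mu> div k))
      - 1 / 2 * (\<Sum>\<mu> = 1..k-1. of_int \<mu>)"
    by (simp only: sum_subtractf sum_distrib_left)
  also have "\<dots> = of_int h * (k - 1) * (2 * k - 1) / 6
     - (\<Sum>\<mu> = 1..k-1. of_int \<mu> * of_int (h * \<mu> div k)) - of_int k * (k - 1) / 4"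
    unfolding sum_linear sum_square using k by simp (simp add: algebra_simps)
  finally show ?thesis .
qed

text \<open>
  Equating the sums of squares of $((h\mu/k))$ and $((\mu/k))$ and expanding gives a relation
  between the quadratic and the linear sums of the floors $\lfloor h\mu/k\rfloor$.
\<close>
lemma sum_floor_square:
  "of_int k * (\<Sum>\<mu> = 1..k-1. of_int (h * \<mu> div k) * (of_int (h * \<mu> div k) + 1))
   = 2 * of_int h * (\<Sum>\<mu> = 1..k-1. of_int \<mu> * of_int (h * \<mu> div k))
     + of_int h * of_int k * (k - 1) / 2 - (of_int h)\<^sup>2 * (k - 1) * (2 * k - 1) / 6
     + (k - 1) * (2 * k - 1) / 6 - of_int k * (k - 1) / (2::real)"
proof -
  let ?q = "\<lambda>\<mu>. real_of_int (h * \<mu> div k)" and ?s = "\<lambda>\<mu>. sawtooth (of_int (h * \<mu>) / of_int k)"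
  have "(\<Sum>\<mu> = 1..k-1. (?s \<mu>)\<^sup>2) = (\<Sum>\<mu> = 1..k-1. (sawtooth (of_int \<mu> / of_int k))\<^sup>2)"
    by (rule sum_sawtooth_permute) simp
  also have "\<dots> = (\<Sum>\<mu> = 1..k-1. 1 / (of_int k)\<^sup>2 * (of_int \<mu>)\<^sup>2 - 1 / of_int k * of_int \<mu> + 1 / 4)"
  proof (rule sum.cong[OF refl])
    fix \<mu> assume "\<mu> \<in> {1..k-1}"
    then show "(sawtooth (of_int \<mu> / of_int k))\<^sup>2 = 1 / (of_int k)\<^sup>2 * (of_int \<mu>)\<^sup>2 - 1 / of_int k * of_int \<mu> + 1 / 4"
      using k by (simp only: sawtooth_divide) (simp add: field_simps power2_eq_square)
  qed
  also have "\<dots> = 1 / (of_int k)\<^sup>2 * (\<Sum>\<mu> = 1..k-1. (of_int \<mu>)\<^sup>2) - 1 / of_int k * (\<Sum>\<mu> = 1..k-1. of_int \<mu>)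
      + (k - 1) / 4"
    using k by (simp add: sum.distrib sum_subtractf sum_distrib_left)
  finally have 1: "(\<Sum>\<mu> = 1..k-1. (?s \<mu>)\<^sup>2) = \<dots>" .
  \<comment> \<open>With $u = h/k$ as an atom the expansions are polynomial identities.\<close>
  define u where "u = real_of_int h / of_int k"
  have sq: "(u * m - q - 1 / 2)\<^sup>2 = u\<^sup>2 * m\<^sup>2 + q * (q + 1) - 2 * u * (m * q) - u * m + 1 / 4" for m q :: real
    by (simp add: power2_eq_square algebra_simps)
  have "(\<Sum>\<mu> = 1..k-1. (?s \<mu>)\<^sup>2) = (\<Sum>\<mu> = 1..k-1. u\<^sup>2 * (of_int \<mu>)\<^sup>2 + ?q \<mu> * (?q \<mu> + 1)
      - 2 * u * (of_int \<mu> * ?q \<mu>) - u * of_int \<mu> + 1 / 4)"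
  proof (rule sum.cong[OF refl])
    fix \<mu> assume \<mu>: "\<mu> \<in> {1..k-1}"
    have "?s \<mu> = u * of_int \<mu> - ?q \<mu> - 1 / 2"
      unfolding sawtooth_mult_divide[OF \<mu>] u_def by simp
    then show "(?s \<mu>)\<^sup>2 = u\<^sup>2 * (of_int \<mu>)\<^sup>2 + ?q \<mu> * (?q \<mu> + 1) - 2 * u * (of_int \<mu> * ?q \<mu>) - u * of_int \<mu> + 1 / 4"
      by (simp only: sq)
  qed
  also have "\<dots> = u\<^sup>2 * (\<Sum>\<mu> = 1..k-1. (of_int \<mu>)\<^sup>2) + (\<Sum>\<mu> = 1..k-1. ?q \<mu> * (?q \<mu> + 1))
      - 2 * u * (\<Sum>\<mu> = 1..k-1. of_int \<mu> * ?q \<mu>) - u * (\<Sum>\<mu> = 1..k-1. of_int \<mu>)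
      + (k - 1) / 4"
    using k by (simp add: sum.distrib sum_subtractf flip: sum_distrib_left)
  finally have 2: "(\<Sum>\<mu> = 1..k-1. (?s \<mu>)\<^sup>2) = \<dots>" .
  define G H where "G = (\<Sum>\<mu> = 1..k-1. ?q \<mu> * (?q \<mu> + 1))" and "H = (\<Sum>\<mu> = 1..k-1. of_int \<mu> * ?q \<mu>)"
  have "u\<^sup>2 * ((k - 1) * k * (2 * k - 1) / 6) + G - 2 * u * H - u * ((k - 1) * k / 2) + (k - 1) / 4
    = 1 / (of_int k)\<^sup>2 * ((k - 1) * k * (2 * k - 1) / 6) - 1 / of_int k * ((k - 1) * k / 2) + (k - 1) / (4::real)"
    (is "?L = ?R")
    using 1 2 unfolding sum_linear sum_square G_def H_def by simp
  moreover have "of_int k * ?L = (u * k)\<^sup>2 * (k - 1) * (2 * k - 1) / 6 + of_int k * G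
      - 2 * (u * k) * H - (u * k) * of_int k * (k - 1) / 2 + of_int k * (k - 1) / (4::real)"
    by (simp add: algebra_simps power2_eq_square)
  moreover have "of_int k * ?R = (k - 1) * (2 * k - 1) / 6 - of_int k * (k - 1) / 2 + of_int k * (k - 1) / (4::real)"
  proof -
    have "1 / (real_of_int k)\<^sup>2 * ((k - 1) * k * (2 * k - 1) / 6) = (k - 1) * (2 * k - 1) / 6 / k"
      "1 / real_of_int k * ((k - 1) * k / 2) = (k - 1) / 2"
      using k by (simp_all add: power2_eq_square)
    moreover have "of_int k * (A / of_int k - B + C) = A - of_int k * B + of_int k * C" for A B C :: real
      using k by (simp add: distrib_left right_diff_distrib)
    ultimately show ?thesis by (simp only:) simp
  qed
  moreover have "u * k = of_int h" using k by (simp add: u_def)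
  ultimately have "of_int k * G = 2 * of_int h * H
     + of_int h * of_int k * (k - 1) / 2 - (of_int h)\<^sup>2 * (k - 1) * (2 * k - 1) / 6
     + (k - 1) * (2 * k - 1) / 6 - of_int k * (k - 1) / (2::real)"
    by simp
  then show ?thesis by (simp add: G_def H_def)
qed

text \<open>
  Writing $q(q+1) = 2\sum_{\nu \le q} \nu$ and exchanging the sums over $\mu$ and $\nu$ adds up
  the heights $\nu$ of the lattice points below the diagonal of the $k \times h$ rectangle by
  rows instead of by columns. This turns the quadratic sum for $h/k$ into the linear sum for
  $k/h$; coprimality keeps lattice points off the diagonal.
\<close>
lemma sum_floor_double_count:
  assumes h: "h > 0"
  shows "(\<Sum>\<mu> = 1..k-1. of_int (h * \<mu> div k) * (of_int (h * \<mu> div k) + 1))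
    = of_int h * (h - 1) * (k - 1) - 2 * (\<Sum>\<nu> = 1..h-1. real_of_int \<nu> * of_int (k * \<nu> div h))"
proof -
  let ?q = "\<lambda>\<mu>. h * \<mu> div k" and ?r = "\<lambda>\<nu>. k * \<nu> div h"
  have "real_of_int (?q \<mu>) * (of_int (?q \<mu>) + 1) = 2 * (\<Sum>\<nu> = 1..h-1. if \<nu> \<le> ?q \<mu> then of_int \<nu> else 0)"
    if \<mu>: "\<mu> \<in> {1..k-1}" for \<mu>
  proof -
    have "0 \<le> ?q \<mu>" using h k \<mu> by (simp add: pos_imp_zdiv_nonneg_iff)
    have "\<not> h \<le> ?q \<mu>" using h \<mu> k by (simp add: int_le_div_iff)
    then have "{\<nu>\<in>{1..h-1}. \<nu> \<le> x} = {1..x}" if "x = ?q \<mu>" for x using that by auto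
    then have "{\<nu>\<in>{1..h-1}. \<nu> \<le> ?q \<mu>} = {1..?q \<mu>}" by blast
    then have "(\<Sum>\<nu> = 1..h-1. if \<nu> \<le> ?q \<mu> then real_of_int \<nu> else 0) = (\<Sum>\<nu> = 1..?q \<mu>. of_int \<nu>)"
      by (simp only: sum.inter_filter[OF finite_atLeastAtMost_int, symmetric])
    then show ?thesis using sum_int_upto[OF \<open>0 \<le> ?q \<mu>\<close>] by simp
  qed
  then have "(\<Sum>\<mu> = 1..k-1. real_of_int (?q \<mu>) * (of_int (?q \<mu>) + 1))
    = (\<Sum>\<mu> = 1..k-1. 2 * (\<Sum>\<nu> = 1..h-1. if \<nu> \<le> ?q \<mu> then of_int \<nu> else 0))"
    by (rule sum.cong[OF refl])
  also have "\<dots> = 2 * (\<Sum>\<mu> = 1..k-1. \<Sum>\<nu> = 1..h-1. if \<nu> \<le> ?q \<mu> then of_int \<nu> else 0)"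
    by (simp only: sum_distrib_left)
  also have "(\<Sum>\<mu> = 1..k-1. \<Sum>\<nu> = 1..h-1. if \<nu> \<le> ?q \<mu> then real_of_int \<nu> else 0)
    = (\<Sum>\<nu> = 1..h-1. \<Sum>\<mu> = 1..k-1. if \<nu> \<le> ?q \<mu> then of_int \<nu> else 0)"
    by (rule sum.swap)
  also have "\<dots> = (\<Sum>\<nu> = 1..h-1. of_int \<nu> * (of_int (k - 1) - of_int (?r \<nu>)))"
  proof (rule sum.cong[OF refl])
    fix \<nu> assume \<nu>: "\<nu> \<in> {1..h-1}"
    have r: "0 \<le> ?r \<nu>" "?r \<nu> \<le> k - 1"
    proof -
      show "0 \<le> ?r \<nu>" using h k \<nu> by (simp add: pos_imp_zdiv_nonneg_iff)
      have "\<not> k \<le> ?r \<nu>" using h k \<nu> by (simp add: int_le_div_iff)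
      then show "?r \<nu> \<le> k - 1" by simp
    qed
    have "\<not> h dvd \<nu>" using \<nu> zdvd_not_zless by auto
    then have nd: "\<not> h dvd \<nu> * k" using cop by (simp add: coprime_dvd_mult_left_iff)
    have "\<nu> \<le> ?q \<mu> \<longleftrightarrow> ?r \<nu> < \<mu>" for \<mu>
    proof -
      have "\<nu> \<le> ?q \<mu> \<longleftrightarrow> \<nu> * k \<le> h * \<mu>" using k by (rule int_le_div_iff)
      also have "\<dots> \<longleftrightarrow> \<nu> * k < h * \<mu>"
      proof -
        have "\<nu> * k \<noteq> h * \<mu>"
        proof
          assume "\<nu> * k = h * \<mu>"
          then have "h dvd \<nu> * k" by (rule dvdI)
          with nd show False by simp
        qed
        then show ?thesis by (auto simp only: less_le)
      qed
      also have "\<dots> \<longleftrightarrow> ?r \<nu> < \<mu>"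
        by (simp only: int_le_div_iff[OF h] not_le[symmetric] mult.commute[of \<nu> k] mult.commute[of h \<mu>])
      finally show ?thesis .
    qed
    then have "(\<Sum>\<mu> = 1..k-1. if \<nu> \<le> ?q \<mu> then real_of_int \<nu> else 0) = (\<Sum>\<mu>\<in>{\<mu>\<in>{1..k-1}. ?r \<nu> < \<mu>}. of_int \<nu>)"
      by (simp only: sum.inter_filter[OF finite_atLeastAtMost_int, symmetric])
    also have "\<dots> = of_int \<nu> * (of_int (k - 1) - of_int (?r \<nu>))"
    proof -
      have "(\<Sum>\<mu>\<in>{\<mu>\<in>{1..k-1}. x < \<mu>}. y) = y * (of_int (k - 1) - of_int x)" if "0 \<le> x" "x \<le> k - 1" for x and y :: real
      proof -
        have "{\<mu>\<in>{1..k-1}. x < \<mu>} = {x+1..k-1}" using that by auto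
        then show ?thesis using that by simp
      qed
      from this[OF r] show ?thesis .
    qed
    finally show "(\<Sum>\<mu> = 1..k-1. if \<nu> \<le> ?q \<mu> then real_of_int \<nu> else 0) = of_int \<nu> * (of_int (k - 1) - of_int (?r \<nu>))" .
  qed
  also have "\<dots> = of_int (k - 1) * (\<Sum>\<nu> = 1..h-1. of_int \<nu>) - (\<Sum>\<nu> = 1..h-1. real_of_int \<nu> * of_int (?r \<nu>))"
    by (simp only: right_diff_distrib sum_subtractf sum_distrib_left mult.commute[of _ "real_of_int (k - 1)"])
  also have "(\<Sum>\<nu> = 1..h-1. real_of_int \<nu>) = of_int h * (h - 1) / 2"
    using sum_int_upto[of "h-1"] h by simp
  finally show ?thesis by simp
qed

end

text \<open>
  By the two lemmas \<open>sum_floor_square\<close> and \<open>sum_floor_double_count\<close>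
  the linear floor sums for $h/k$ and for $k/h$ satisfy one linear relation, and these sums are
  the two Dedekind sums up to elementary terms.
\<close>
lemma dedekind_reciprocity:
  assumes "coprime h k" "h > 0" "k > 0"
  shows "12 * of_int h * of_int k * (dedekind_sum h k + dedekind_sum k h)
    = (of_int h)\<^sup>2 + (of_int k)\<^sup>2 + 1 - 3 * of_int h * of_int k"
proof -
  have cop: "coprime k h" using assms by (simp add: coprime_commute)
  define H where "H = (\<Sum>\<mu> = 1..k-1. real_of_int \<mu> * of_int (h * \<mu> div k))"
  define H' where "H' = (\<Sum>\<mu> = 1..h-1. real_of_int \<mu> * of_int (k * \<mu> div h))"
  have H: "H = of_int h * (k - 1) * (2 * k - 1) / 6 - of_int k * (k - 1) / 4 - of_int k * dedekind_sum h k"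
    using dedekind_sum_floor[OF assms(1,3)] by (simp add: H_def)
  have H': "H' = of_int k * (h - 1) * (2 * h - 1) / 6 - of_int h * (h - 1) / 4 - of_int h * dedekind_sum k h"
    using dedekind_sum_floor[OF cop assms(2)] by (simp add: H'_def)
  have "of_int k * (of_int h * (h - 1) * (k - 1) - 2 * H') = 2 * of_int h * H
     + of_int h * of_int k * (k - 1) / 2 - (of_int h)\<^sup>2 * (k - 1) * (2 * k - 1) / 6
     + (k - 1) * (2 * k - 1) / 6 - of_int k * (k - 1) / 2"
    using sum_floor_square[OF assms(1,3)] sum_floor_double_count[OF assms(1,3,2)]
    by (simp only: H_def H'_def)
  then show ?thesis unfolding H H' by (simp add: field_simps power2_eq_square)
qed


section \<open>The Rademacher symbol under the generators\<close>

lemma rademacher_mat2: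
  "rademacher (mat2 a b c d) = (if c = 0 then of_int b / of_int d
      else of_int (a + d) / of_int c - 12 * of_int (sgn c) * dedekind_sum d \<bar>c\<bar>)"
  by (simp add: rademacher_def)

lemma rademacher_uminus: "rademacher (- A) = rademacher A"
proof -
  obtain a b c d where A: "A = mat2 a b c d" by (rule mat2_cases)
  have "real_of_int (- a + - d) / of_int (- c) = of_int (a + d) / of_int c"
    unfolding minus_add_distrib[symmetric] of_int_minus minus_divide_divide ..
  then show ?thesis
    by (simp add: A mat2_uminus rademacher_mat2 dedekind_sum_minus)
qed

text \<open>
  Dedekind sums are odd in the first argument, so reciprocity for $|a|$ and $|c|$ extends to all
  signs. The sign of $a c$ in front of the constant term is the one that appears in the
  transformation of $\Phi$ under $S$.
\<close>
lemma dedekind_reciprocity_signed: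
  assumes "coprime a c" "a \<noteq> 0" "c \<noteq> 0"
  shows "12 * (of_int (sgn a) * dedekind_sum c \<bar>a\<bar> + of_int (sgn c) * dedekind_sum a \<bar>c\<bar>)
     = (of_int a ^ 2 + of_int c ^ 2 + 1) / (of_int a * of_int c) - 3 * of_int (sgn (a * c))"
proof -
  have red: "dedekind_sum x m = of_int (sgn x) * dedekind_sum \<bar>x\<bar> m" if "x \<noteq> 0" for x m
    using that dedekind_sum_minus[of x m] by (cases "x > 0") simp_all
  have "12 * of_int \<bar>a\<bar> * of_int \<bar>c\<bar> * (dedekind_sum \<bar>a\<bar> \<bar>c\<bar> + dedekind_sum \<bar>c\<bar> \<bar>a\<bar>)
    = (of_int \<bar>a\<bar>)\<^sup>2 + (of_int \<bar>c\<bar>)\<^sup>2 + 1 - 3 * of_int \<bar>a\<bar> * real_of_int \<bar>c\<bar>"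
    using assms by (intro dedekind_reciprocity) auto
  then have "12 * (dedekind_sum \<bar>a\<bar> \<bar>c\<bar> + dedekind_sum \<bar>c\<bar> \<bar>a\<bar>)
    = ((of_int a)\<^sup>2 + (of_int c)\<^sup>2 + 1) / (of_int \<bar>a\<bar> * of_int \<bar>c\<bar>) - 3"
    using assms by (simp add: field_simps)
  then have "of_int (sgn (a * c)) * (12 * (dedekind_sum \<bar>a\<bar> \<bar>c\<bar> + dedekind_sum \<bar>c\<bar> \<bar>a\<bar>))
    = of_int (sgn (a * c)) * (((of_int a)\<^sup>2 + (of_int c)\<^sup>2 + 1) / (of_int \<bar>a\<bar> * of_int \<bar>c\<bar>) - 3)" by simp
  moreover have "of_int (sgn (a * c)) * (((of_int a)\<^sup>2 + (of_int c)\<^sup>2 + 1) / (of_int \<bar>a\<bar> * of_int \<bar>c\<bar>))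
    = ((of_int a)\<^sup>2 + (of_int c)\<^sup>2 + 1) / (of_int a * real_of_int c)"
  proof -
    have "real_of_int a * of_int c = of_int (sgn (a * c)) * (of_int \<bar>a\<bar> * of_int \<bar>c\<bar>)"
      by (metis abs_mult of_int_mult sgn_mult_abs)
    moreover have "real_of_int (sgn (a * c)) * of_int (sgn (a * c)) = 1"
      using assms by (auto simp: sgn_if)
    ultimately show ?thesis using assms
      by (simp only:) (simp add: divide_simps)
  qed
  moreover have "12 * (of_int (sgn a) * dedekind_sum c \<bar>a\<bar> + of_int (sgn c) * dedekind_sum a \<bar>c\<bar>)
    = of_int (sgn (a * c)) * (12 * (dedekind_sum \<bar>a\<bar> \<bar>c\<bar> + dedekind_sum \<bar>c\<bar> \<bar>a\<bar>))"
    unfolding red[OF assms(2), of "\<bar>c\<bar>"] red[OF assms(3), of "\<bar>a\<bar>"] sgn_mult of_int_mult by (simp add: algebra_simps)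
  ultimately show ?thesis by (simp only: right_diff_distrib)
qed

text \<open>
  If $a c \neq 0$, the determinant relation says that $-c$ is inverse to $b$ modulo $a$ and that
  $a$ is inverse to $d$ modulo $c$. Hence the two symbols involve $s(c,|a|)$ and $s(a,|c|)$
  only, and their difference is what reciprocity evaluates.
\<close>
lemma rademacher_S_mult:
  assumes det: "a * d - b * c = 1"
  shows "rademacher (mat2 (- c) (- d) a b) = rademacher (mat2 a b c d) - 3 * of_int (sgn (a * c))"
proof (cases "a = 0 \<or> c = 0")
  case True
  then show ?thesis
  proof
    assume "a = 0"
    then have "b * (- c) = 1" using det by simp
    then have "b = 1 \<and> - c = 1 \<or> b = -1 \<and> - c = -1" by (simp only: zmult_eq_1_iff)
    then have "b = 1 \<and> c = -1 \<or> b = -1 \<and> c = 1" by auto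
    then show ?thesis using \<open>a = 0\<close> by (auto simp: rademacher_mat2)
  next
    assume "c = 0"
    then have "a = 1 \<and> d = 1 \<or> a = -1 \<and> d = -1" using det by (auto simp: zmult_eq_1_iff)
    then show ?thesis using \<open>c = 0\<close> by (auto simp: rademacher_mat2)
  qed
next
  case False
  then have a: "a \<noteq> 0" and c: "c \<noteq> 0" by auto
  have cop: "coprime a c"
  proof (rule coprimeI)
    fix e assume "e dvd a" "e dvd c"
    then have "e dvd a * d - b * c" by simp
    then show "is_unit e" by (simp add: det)
  qed
  have "dedekind_sum (- b) \<bar>a\<bar> = dedekind_sum c \<bar>a\<bar>"
  proof (rule dedekind_sum_inverse)
    have "- b * c - 1 = - (a * d)" using det by simp
    then show "- b * c mod \<bar>a\<bar> = 1 mod \<bar>a\<bar>" by (simp add: mod_eq_dvd_iff)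
  qed (use a in simp)
  then have sb: "dedekind_sum b \<bar>a\<bar> = - dedekind_sum c \<bar>a\<bar>" by (simp add: dedekind_sum_minus)
  have sd: "dedekind_sum d \<bar>c\<bar> = dedekind_sum a \<bar>c\<bar>"
  proof (rule dedekind_sum_inverse)
    have "d * a - 1 = b * c" using det by (simp add: mult.commute)
    then show "d * a mod \<bar>c\<bar> = 1 mod \<bar>c\<bar>" by (simp add: mod_eq_dvd_iff)
  qed (use c in simp)
  have rdet: "real_of_int a * d - b * c = 1" using det by (metis of_int_1 of_int_diff of_int_mult)
  have "(real_of_int a + d) / c - (real_of_int b - c) / a
      = (real_of_int a ^ 2 + of_int c ^ 2 + (real_of_int a * d - b * c)) / (of_int a * of_int c)"
    using a c by (simp add: field_simps power2_eq_square)
  then show ?thesis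
    using a c dedekind_reciprocity_signed[OF cop a c] unfolding rdet
    by (simp add: rademacher_mat2 sb sd)
qed

lemma rademacher_T_mult:
  assumes "a * d - b * c = 1"
  shows "rademacher (mat2 (a + n * c) (b + n * d) c d) = rademacher (mat2 a b c d) + of_int n"
proof (cases "c = 0")
  case True
  then have "d \<noteq> 0" using assms by auto
  then show ?thesis using True by (simp add: rademacher_mat2 field_simps)
next
  case False
  then show ?thesis by (simp add: rademacher_mat2 field_simps)
qed

section \<open>Characteristic polynomials of tridiagonal matrices\<close>

text \<open>
  The characteristic polynomial of the tridiagonal matrix of a list, by the three-term
  recursion. The coefficient ring is left open because the polynomials are evaluated at complex
  numbers, too.
\<close>
fun jacobi_poly :: "int list \<Rightarrow> 'a::comm_ring_1 poly" where
  "jacobi_poly [] = 1"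
| "jacobi_poly [n] = [:- of_int n, 1:]"
| "jacobi_poly (n # m # \<alpha>) = [:- of_int n, 1:] * jacobi_poly (m # \<alpha>) - jacobi_poly \<alpha>"

text \<open>
  The characteristic polynomial of the matrix without its first row and column. The value $0$
  for the empty list makes the three-term recursion hold from the first step on.
\<close>
definition jacobi_minor :: "int list \<Rightarrow> 'a::comm_ring_1 poly" where
  "jacobi_minor \<alpha> = (case \<alpha> of [] \<Rightarrow> 0 | _ # \<beta> \<Rightarrow> jacobi_poly \<beta>)"

lemma jacobi_minor_simps [simp]:
  "jacobi_minor [] = 0" "jacobi_minor (n # \<alpha>) = jacobi_poly \<alpha>"
  by (simp_all add: jacobi_minor_def)

lemma jacobi_poly_Cons:
  "jacobi_poly (n # \<alpha>) = [:- of_int n, 1:] * jacobi_poly \<alpha> - jacobi_minor \<alpha>"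
  by (cases \<alpha>) simp_all

definition jacobi_mat :: "int list \<Rightarrow> real poly Matrix.mat" where
  "jacobi_mat \<alpha> = Matrix.mat (length \<alpha>) (length \<alpha>)
     (\<lambda>(i, j). if i = j then [:- of_int (\<alpha> ! i), 1:] else if i = j + 1 \<or> j = i + 1 then -1 else 0)"

lemma char_poly_matrix_path_tridiag: "char_poly_matrix (path_tridiag \<alpha>) = jacobi_mat \<alpha>"
  by (rule eq_matI) (auto simp: char_poly_matrix_def path_tridiag_def jacobi_mat_def one_pCons)

lemma jacobi_mat_carrier [simp]: "jacobi_mat \<alpha> \<in> carrier_mat (length \<alpha>) (length \<alpha>)"
  by (simp add: jacobi_mat_def)

text \<open>
  Expansion along the first row leaves two terms; the second minor has a single nonzero entry in
  its first column, so a second expansion leads to the matrix of the list without its first two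
  entries.
\<close>
lemma det_jacobi_mat: "Determinant.det (jacobi_mat \<alpha>) = jacobi_poly \<alpha>"
proof (induction \<alpha> rule: jacobi_poly.induct)
  case 1
  then show ?case by (simp add: jacobi_mat_def)
next
  case (2 n)
  then show ?case by (subst det_single) (auto simp: jacobi_mat_def)
next
  case (3 n m \<alpha>)
  let ?A = "jacobi_mat (n # m # \<alpha>)" and ?N = "length (n # m # \<alpha>)"
  let ?B = "mat_delete ?A 0 (Suc 0)"
  have del00: "mat_delete ?A 0 0 = jacobi_mat (m # \<alpha>)"
    by (rule eq_matI) (auto simp: mat_delete_def jacobi_mat_def)
  have del: "mat_delete ?B 0 0 = jacobi_mat \<alpha>"
    by (rule eq_matI) (auto simp: mat_delete_def jacobi_mat_def)
  have B: "?B \<in> carrier_mat (Suc (length \<alpha>)) (Suc (length \<alpha>))"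
    by (simp add: jacobi_mat_def mat_delete_def)
  have "Determinant.det ?B = (\<Sum>i<Suc (length \<alpha>). ?B $$ (i, 0) * cofactor ?B i 0)"
    by (rule laplace_expansion_column[OF B]) simp
  also have "\<dots> = (\<Sum>i\<in>{0}. ?B $$ (i, 0) * cofactor ?B i 0)"
    by (rule sum.mono_neutral_right) (auto simp: jacobi_mat_def mat_delete_def)
  also have "\<dots> = - Determinant.det (jacobi_mat \<alpha>)"
  proof -
    have "?B $$ (0, 0) = -1" by (simp add: jacobi_mat_def mat_delete_def)
    then show ?thesis by (simp add: cofactor_def del)
  qed
  finally have detB: "Determinant.det ?B = - jacobi_poly \<alpha>" using 3 by simp
  have "Determinant.det ?A = (\<Sum>j<?N. ?A $$ (0, j) * cofactor ?A 0 j)"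
    by (rule laplace_expansion_row[OF jacobi_mat_carrier]) simp
  also have "\<dots> = (\<Sum>j\<in>{0, 1}. ?A $$ (0, j) * cofactor ?A 0 j)"
    by (rule sum.mono_neutral_right) (auto simp: jacobi_mat_def)
  also have "\<dots> = [:- of_int n, 1:] * jacobi_poly (m # \<alpha>) - jacobi_poly \<alpha>"
  proof -
    have "?A $$ (0, 0) = [:- of_int n, 1:]" "?A $$ (0, 1) = -1" by (simp_all add: jacobi_mat_def)
    then show ?thesis using 3 detB by (simp add: cofactor_def del00)
  qed
  finally show ?case by simp
qed

lemma char_poly_path_tridiag: "char_poly (path_tridiag \<alpha>) = jacobi_poly \<alpha>"
  by (simp add: char_poly_def char_poly_matrix_path_tridiag det_jacobi_mat)

text \<open>
  The three-term recursion adds the square of the previous polynomial to the Wronskian, so that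
  it is a sum of squares of all the earlier polynomials, the first of which is $1$ (the
  confluent Christoffel--Darboux formula).
\<close>
lemma wronskian_jacobi_pos:
  fixes x :: real
  assumes "\<alpha> \<noteq> []"
  shows "poly (pderiv (jacobi_poly \<alpha>)) x * poly (jacobi_minor \<alpha>) x
       - poly (jacobi_poly \<alpha>) x * poly (pderiv (jacobi_minor \<alpha>)) x > 0"
  using assms
proof (induction \<alpha>)
  case (Cons n \<alpha>)
  let ?W = "\<lambda>\<alpha>. poly (pderiv (jacobi_poly \<alpha>)) x * poly (jacobi_minor \<alpha>) x
       - poly (jacobi_poly \<alpha>) x * poly (pderiv (jacobi_minor \<alpha>)) x"
  have "?W (n # \<alpha>) = poly (jacobi_poly \<alpha>) x ^ 2 + ?W \<alpha>"
    unfolding jacobi_poly_Cons jacobi_minor_simps pderiv_diff pderiv_mult pderiv_pCons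
    by (simp add: algebra_simps power2_eq_square)
  moreover have "\<dots> > 0"
  proof (cases "\<alpha> = []")
    case False
    then show ?thesis using Cons.IH zero_le_power2[of "poly (jacobi_poly \<alpha>) x"] by linarith
  qed simp
  ultimately show ?case by (simp only:)
qed simp

text \<open>
  The same induction as for the Wronskian, with the imaginary part of $P \overline{Q}$ in place
  of the Wronskian: a step adds $\mathrm{Im}(z)\,|P|^2$. The product with $\mathrm{Im}\, z$
  treats both half planes at once.
\<close>
lemma jacobi_poly_nonreal:
  fixes z :: complex
  assumes "Im z \<noteq> 0"
  shows "poly (jacobi_poly \<alpha>) z \<noteq> 0 \<and>
    Im z * Im (poly (jacobi_poly \<alpha>) z * cnj (poly (jacobi_minor \<alpha>) z)) \<ge> 0"
proof (induction \<alpha>)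
  case (Cons n \<alpha>)
  let ?f = "poly (jacobi_poly \<alpha>) z" and ?g = "poly (jacobi_minor \<alpha>) z"
  have "Im z * Im (poly (jacobi_poly (n # \<alpha>)) z * cnj ?f)
      = (Im z)\<^sup>2 * (cmod ?f)\<^sup>2 + Im z * Im (?f * cnj ?g)"
    unfolding jacobi_poly_Cons cmod_power2 by (simp add: algebra_simps power2_eq_square)
  moreover have "(Im z)\<^sup>2 * (cmod ?f)\<^sup>2 > 0" using Cons assms by simp
  ultimately have "Im z * Im (poly (jacobi_poly (n # \<alpha>)) z * cnj ?f) > 0" using Cons by linarith
  then show ?case by auto
qed simp

lemma poly_jacobi_poly_of_real:
  "poly (jacobi_poly \<alpha>) (complex_of_real x) = complex_of_real (poly (jacobi_poly \<alpha>) x)"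
  by (induction \<alpha> rule: jacobi_poly.induct) simp_all

lemma degree_lead_coeff_jacobi_poly:
  "degree (jacobi_poly \<alpha> :: 'a::idom poly) = length \<alpha> \<and> lead_coeff (jacobi_poly \<alpha> :: 'a poly) = 1"
proof (induction \<alpha> rule: jacobi_poly.induct)
  case (3 n m \<alpha>)
  let ?p = "jacobi_poly (m # \<alpha>) :: 'a poly" and ?l = "[:- of_int n, 1:] :: 'a poly"
  have "?p \<noteq> 0" using 3 by auto
  then have deg: "degree (?l * ?p) = length (n # m # \<alpha>)" using 3 by (simp add: degree_mult_eq del: mult_pCons_left)
  have lt: "degree (- jacobi_poly \<alpha> :: 'a poly) < degree (?l * ?p)" using 3 deg by simp
  have lc: "lead_coeff (?l * ?p) = 1" 
  proof -
    have "lead_coeff ?p = 1" "lead_coeff ?l = 1" using 3 by (blast, simp)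
    then show ?thesis by (metis lead_coeff_mult mult_1)
  qed
  have eq: "jacobi_poly (n # m # \<alpha>) = - jacobi_poly \<alpha> + ?l * ?p" by simp
  show ?case unfolding eq using deg lc lead_coeff_add_le[OF lt] degree_add_eq_right[OF lt] by metis
qed simp_all

lemma jacobi_poly_real_rooted:
  obtains bs :: "real list" where "jacobi_poly \<alpha> = (\<Prod>b\<leftarrow>bs. [:- b, 1:])"
proof -
  let ?p = "jacobi_poly \<alpha> :: complex poly"
  obtain as where as: "Polynomial.smult (lead_coeff ?p) (\<Prod>a\<leftarrow>as. [:- a, 1:]) = ?p"
    using fundamental_theorem_algebra_factorized[of ?p] by blast
  have real: "a \<in> \<real>" if "a \<in> set as" for a
  proof -
    have "poly ?p a = 0" using that by (subst as[symmetric]) (auto simp: poly_prod_list prod_list_zero_iff)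
    then show ?thesis using jacobi_poly_nonreal[of a \<alpha>] by (auto simp: complex_is_Real_iff)
  qed
  have lc: "lead_coeff ?p = 1" using degree_lead_coeff_jacobi_poly by blast
  have "jacobi_poly \<alpha> = (\<Prod>b\<leftarrow>map Re as. [:- b, 1:])"
  proof (rule poly_ext)
    fix x :: real
    have "complex_of_real (poly (jacobi_poly \<alpha>) x) = (\<Prod>a\<leftarrow>as. complex_of_real x - a)"
      using lc by (subst poly_jacobi_poly_of_real[symmetric], subst as[symmetric])
        (simp add: poly_prod_list o_def)
    also have "\<dots> = (\<Prod>a\<leftarrow>as. complex_of_real (x - Re a))"
      using real by (intro arg_cong[where f = prod_list] map_cong) (auto simp: complex_is_Real_iff complex_eq_iff)
    also have "\<dots> = complex_of_real (\<Prod>a\<leftarrow>as. x - Re a)"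
      by (induction as) simp_all
    finally show "poly (jacobi_poly \<alpha>) x = poly (\<Prod>b\<leftarrow>map Re as. [:- b, 1:]) x"
      by (simp add: poly_prod_list o_def)
  qed
  then show ?thesis by (rule that)
qed


section \<open>Eigenvalues and signature of tridiagonal matrices\<close>

definition jacobi_roots :: "int list \<Rightarrow> real set" where
  "jacobi_roots \<alpha> = {x. poly (jacobi_poly \<alpha>) x = 0}"

text \<open>
  At a multiple root both the polynomial and its derivative vanish, and so would the Wronskian.
\<close>
lemma jacobi_poly_simple_root:
  assumes "x \<in> jacobi_roots \<alpha>"
  shows "Polynomial.order x (jacobi_poly \<alpha>) = 1"
proof -
  have "\<alpha> \<noteq> []" using assms by (auto simp: jacobi_roots_def)
  with assms wronskian_jacobi_pos[of \<alpha> x] have *: "poly (pderiv (jacobi_poly \<alpha>)) x \<noteq> 0" 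
    by (auto simp: jacobi_roots_def)
  have nz: "jacobi_poly \<alpha> \<noteq> (0 :: real poly)" using degree_lead_coeff_jacobi_poly[of \<alpha>, where 'a = real] by auto
  have "Polynomial.order x (jacobi_poly \<alpha>) \<noteq> 0" using assms nz by (auto simp: jacobi_roots_def order_root)
  moreover have "Polynomial.order x (pderiv (jacobi_poly \<alpha>)) = 0" using * by (simp add: order_root)
  moreover have "pderiv (jacobi_poly \<alpha>) \<noteq> (0 :: real poly)" using * by (metis poly_0)
  ultimately show ?thesis using order_pderiv[of "jacobi_poly \<alpha>" x] nz assms by (simp add: jacobi_roots_def)
qed

lemma jacobi_poly_eq_prod_roots:
  "jacobi_poly \<alpha> = (\<Prod>x\<in>jacobi_roots \<alpha>. [:- x, 1:])"
  and finite_jacobi_roots: "finite (jacobi_roots \<alpha>)"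
  and card_jacobi_roots: "card (jacobi_roots \<alpha>) = length \<alpha>"
proof -
  obtain bs :: "real list" where bs: "jacobi_poly \<alpha> = (\<Prod>b\<leftarrow>bs. [:- b, 1:])"
    by (rule jacobi_poly_real_rooted)
  have roots: "jacobi_roots \<alpha> = set bs"
    by (auto simp: jacobi_roots_def bs poly_prod_list prod_list_zero_iff)
  have "distinct bs"
  proof (rule ccontr)
    assume "\<not> distinct bs"
    then obtain us x vs ws where bs': "bs = us @ [x] @ vs @ [x] @ ws" using not_distinct_decomp by blast
    have nz: "jacobi_poly \<alpha> \<noteq> (0 :: real poly)" using degree_lead_coeff_jacobi_poly[of \<alpha>, where 'a = real] by auto
    have "[:- x, 1:] ^ 2 dvd jacobi_poly \<alpha>"
      by (simp add: bs bs' power2_eq_square del: mult_pCons_left mult_pCons_right)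
    then have "Polynomial.order x (jacobi_poly \<alpha>) \<ge> 2" using nz by (simp add: order_divides)
    moreover have "x \<in> jacobi_roots \<alpha>" by (simp add: roots bs')
    ultimately show False using jacobi_poly_simple_root by fastforce
  qed
  then show "jacobi_poly \<alpha> = (\<Prod>x\<in>jacobi_roots \<alpha>. [:- x, 1:])"
    by (simp add: roots bs prod.distinct_set_conv_list)
  show "finite (jacobi_roots \<alpha>)" by (simp add: roots)
  have "degree (\<Prod>b\<leftarrow>bs. [:- b, 1:]) = length bs" using degree_linear_factors[of uminus bs] by simp
  then have "length bs = length \<alpha>" using degree_lead_coeff_jacobi_poly[of \<alpha>, where 'a = real] bs by simp
  then show "card (jacobi_roots \<alpha>) = length \<alpha>" using \<open>distinct bs\<close> by (simp add: roots distinct_card)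
qed

lemma signature_path_tridiag:
  "signature (path_tridiag \<alpha>) = int (card {x\<in>jacobi_roots \<alpha>. x > 0}) - int (card {x\<in>jacobi_roots \<alpha>. x < 0})"
proof -
  have car: "path_tridiag \<alpha> \<in> carrier_mat (length \<alpha>) (length \<alpha>)" by (simp add: path_tridiag_def)
  have ev: "eigenvalue (path_tridiag \<alpha>) x \<longleftrightarrow> x \<in> jacobi_roots \<alpha>" for x
    by (simp add: eigenvalue_root_char_poly[OF car] char_poly_path_tridiag jacobi_roots_def)
  have "(\<Sum>x\<in>X. int (Polynomial.order x (jacobi_poly \<alpha>))) = int (card X)" if "X \<subseteq> jacobi_roots \<alpha>" for X
  proof -
    have "(\<Sum>x\<in>X. int (Polynomial.order x (jacobi_poly \<alpha>))) = (\<Sum>x\<in>X. 1)"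
      using that jacobi_poly_simple_root by (intro sum.cong) auto
    then show ?thesis by simp
  qed
  then show ?thesis by (simp add: signature_def ev char_poly_path_tridiag)
qed

text \<open>
  With \<open>jacobi_roots\<close> for the set this reads the parity of the number of negative
  eigenvalues off the sign of the determinant.
\<close>
lemma sgn_prod_reals:
  fixes X :: "real set"
  assumes "finite X"
  shows "sgn (\<Prod>X) = (if 0 \<in> X then 0 else (-1) ^ card {x\<in>X. x < 0})"
  using assms
proof (induction X)
  case (insert x X)
  have "{y \<in> insert x X. y < 0} = (if x < 0 then insert x {y\<in>X. y < 0} else {y\<in>X. y < 0})" by auto
  then show ?case using insert by (auto simp: sgn_mult)
qed simp

text \<open>
  Sending every element of $A$ except the largest one to the next element of $B$ is injective.
\<close>
lemma card_le_Suc_if_separated: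
  fixes A B :: "'a::linorder set"
  assumes "finite A" "finite B" and sep: "\<And>x y. x \<in> A \<Longrightarrow> y \<in> A \<Longrightarrow> x < y \<Longrightarrow> \<exists>z\<in>B. x < z \<and> z < y"
  shows "card A \<le> Suc (card B)"
proof (cases "A = {}")
  case False
  define f where "f x = Min {z\<in>B. x < z}" for x
  have f: "f x \<in> B \<and> x < f x \<and> f x < y" if "x \<in> A" "y \<in> A" "x < y" for x y
  proof -
    obtain z where z: "z \<in> B" "x < z" "z < y" using sep \<open>x \<in> A\<close> \<open>y \<in> A\<close> \<open>x < y\<close> by blast
    then have "f x \<in> {z\<in>B. x < z}" unfolding f_def using assms(2) by (intro Min_in) auto
    moreover have "f x \<le> z" unfolding f_def using assms(2) z by (intro Min_le) auto
    ultimately show ?thesis using z by auto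
  qed
  have lt: "x < Max A" if "x \<in> A - {Max A}" for x
    using that Max_ge[OF assms(1), of x] by (metis DiffD1 DiffD2 order_le_less singletonI)
  have M: "Max A \<in> A" using False assms(1) by simp
  have "inj_on f (A - {Max A})"
  proof (rule linorder_inj_onI')
    fix x y assume "x \<in> A - {Max A}" "y \<in> A - {Max A}" "x < y"
    then show "f x \<noteq> f y" using f[of x y] f[of y "Max A"] lt M by fastforce
  qed
  moreover have "f ` (A - {Max A}) \<subseteq> B" using f lt M by blast
  ultimately have "card (A - {Max A}) \<le> card B" using assms(2) card_inj_on_le by blast
  then show ?thesis using M assms(1) by simp
qed simp

text \<open>
  If $q$ had no zero between two zeros of $p$, Rolle's theorem would apply to $p/q$, whose
  derivative is the Wronskian divided by $q^2$.
\<close>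
lemma root_between_if_wronskian_nonzero:
  fixes p q :: "real poly"
  assumes W: "\<And>x. poly (pderiv p) x * poly q x - poly p x * poly (pderiv q) x \<noteq> 0"
    and "x < y" "poly p x = 0" "poly p y = 0"
  shows "\<exists>z. x < z \<and> z < y \<and> poly q z = 0"
proof (rule ccontr)
  assume *: "\<not> ?thesis"
  have nz: "poly q z \<noteq> 0" if "x \<le> z" "z \<le> y" for z
  proof
    assume "poly q z = 0"
    then show False using W[of x] W[of y] * that assms by (cases "z = x"; cases "z = y") auto
  qed
  let ?f = "\<lambda>z. poly p z / poly q z"
  have der: "(?f has_real_derivative (poly (pderiv p) z * poly q z - poly p z * poly (pderiv q) z) / (poly q z * poly q z)) (at z)"
    if "x \<le> z" "z \<le> y" for z
    by (rule derivative_eq_intros poly_DERIV nz[OF that] refl)+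
  have "\<exists>z. x < z \<and> z < y \<and> DERIV ?f z :> 0"
  proof (rule Rolle[OF \<open>x < y\<close>])
    show "continuous_on {x..y} ?f" using nz by (intro continuous_intros) auto
    show "?f differentiable (at z)" if "x < z" "z < y" for z
      using der[of z] that unfolding real_differentiable_def by auto
  qed (use assms in simp)
  then obtain z where z: "x < z" "z < y" "DERIV ?f z :> 0" by blast
  then have "(poly (pderiv p) z * poly q z - poly p z * poly (pderiv q) z) / (poly q z * poly q z) = 0"
    using DERIV_unique der[of z] by fastforce
  then show False using W[of z] nz[of z] z by simp
qed

text \<open>
  The Wronskian separates zeros in both directions, and the separating zeros remain in an
  order-convex set $J$. This is Cauchy interlacing, localized to $J$; below, $J$ is an open or
  closed half-line at $0$.
\<close>
lemma jacobi_roots_interlace: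
  assumes J: "\<And>x y z. x \<in> J \<Longrightarrow> y \<in> J \<Longrightarrow> x < z \<Longrightarrow> z < y \<Longrightarrow> z \<in> J"
  shows "card (jacobi_roots (n # \<alpha>) \<inter> J) \<le> Suc (card (jacobi_roots \<alpha> \<inter> J))"
    and "card (jacobi_roots \<alpha> \<inter> J) \<le> Suc (card (jacobi_roots (n # \<alpha>) \<inter> J))"
proof -
  let ?P = "jacobi_poly (n # \<alpha>) :: real poly" and ?Q = "jacobi_poly \<alpha> :: real poly"
  have W: "poly (pderiv ?P) x * poly ?Q x - poly ?P x * poly (pderiv ?Q) x > 0" for x
    using wronskian_jacobi_pos[of "n # \<alpha>" x] by simp
  have W1: "poly (pderiv ?P) x * poly ?Q x - poly ?P x * poly (pderiv ?Q) x \<noteq> 0" for x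
    using W[of x] by simp
  have W2: "poly (pderiv ?Q) x * poly ?P x - poly ?Q x * poly (pderiv ?P) x \<noteq> 0" for x
    using W[of x] by (simp add: mult.commute)
  have between: "card (A \<inter> J) \<le> Suc (card (B \<inter> J))"
    if fin: "finite A" "finite B" and sep: "\<And>x y. x \<in> A \<Longrightarrow> y \<in> A \<Longrightarrow> x < y \<Longrightarrow> \<exists>z. x < z \<and> z < y \<and> z \<in> B" for A B
  proof (rule card_le_Suc_if_separated)
    fix x y assume xy: "x \<in> A \<inter> J" "y \<in> A \<inter> J" "x < y"
    then obtain z where "x < z" "z < y" "z \<in> B" using sep by blast
    then show "\<exists>z\<in>B \<inter> J. x < z \<and> z < y" using J[of x y z] xy by blast
  qed (use fin in auto)
  show "card (jacobi_roots (n # \<alpha>) \<inter> J) \<le> Suc (card (jacobi_roots \<alpha> \<inter> J))"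
    using root_between_if_wronskian_nonzero[of ?P ?Q, OF W1]
    by (intro between finite_jacobi_roots) (simp add: jacobi_roots_def)
  show "card (jacobi_roots \<alpha> \<inter> J) \<le> Suc (card (jacobi_roots (n # \<alpha>) \<inter> J))"
    using root_between_if_wronskian_nonzero[of ?Q ?P, OF W2]
    by (intro between finite_jacobi_roots) (simp add: jacobi_roots_def)
qed

lemma card_sign_split:
  fixes X :: "real set"
  assumes "finite X"
  shows "card X = card {x\<in>X. x > 0} + card {x\<in>X. x < 0} + (if 0 \<in> X then 1 else 0)"
proof -
  let ?P = "{x\<in>X. x > 0}" and ?N = "{x\<in>X. x < 0}"
  have "X = (?P \<union> ?N) \<union> (X \<inter> {0})" by force
  moreover have "card ((?P \<union> ?N) \<union> (X \<inter> {0})) = card (?P \<union> ?N) + card (X \<inter> {0})"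
    using assms by (intro card_Un_disjoint) auto
  moreover have "card (?P \<union> ?N) = card ?P + card ?N"
    using assms by (intro card_Un_disjoint) auto
  ultimately show ?thesis by (simp split: if_splits)
qed

text \<open>
  The products of the eigenvalues are the determinants. By interlacing on the two open
  half-lines, the numbers of positive and of negative eigenvalues change by at most one each,
  and their total grows by one if both matrices are regular; the signs of the determinants then
  tell which of the two numbers has grown. If one of the matrices is singular, the other one is
  regular, and both numbers change equally, by $0$ or by $1$.
\<close>
lemma signature_path_tridiag_Cons:
  "real_of_int (signature (path_tridiag (n # \<alpha>))) = of_int (signature (path_tridiag \<alpha>))
     + sgn (\<Prod>(jacobi_roots (n # \<alpha>)) * \<Prod>(jacobi_roots \<alpha>))"
proof -
  let ?A = "jacobi_roots (n # \<alpha>)" and ?B = "jacobi_roots \<alpha>"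
  define a b c d where "a = card {x\<in>?A. x > 0}" and "b = card {x\<in>?A. x < 0}"
    and "c = card {x\<in>?B. x > 0}" and "d = card {x\<in>?B. x < 0}"
  note fin = finite_jacobi_roots[of "n # \<alpha>"] finite_jacobi_roots[of \<alpha>]
  have W: "\<not> (0 \<in> ?A \<and> 0 \<in> ?B)"
    using wronskian_jacobi_pos[of "n # \<alpha>" 0] by (auto simp: jacobi_roots_def)
  have sum: "a + b + (if 0 \<in> ?A then 1 else 0) = c + d + (if 0 \<in> ?B then 1 else 0) + 1"
    using card_sign_split[OF fin(1)] card_sign_split[OF fin(2)]
    by (simp add: card_jacobi_roots a_def b_def c_def d_def)
  have eq: "X \<inter> {0<..} = {x\<in>X. x > 0}" "X \<inter> {..<0} = {x\<in>X. x < 0}"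
    "X \<inter> {0..} = {x\<in>X. x > 0} \<union> (X \<inter> {0})" "X \<inter> {..0} = {x\<in>X. x < 0} \<union> (X \<inter> {0})" for X :: "real set"
    by force+
  have card0: "card (X \<inter> {0::real}) = (if 0 \<in> X then 1 else 0)" for X by auto
  \<comment> \<open>The closed half-lines sharpen the estimates when $0$ is an eigenvalue of the larger matrix.\<close>
  have half: "card (X \<inter> {0..}) = card {x\<in>X. x > 0} + (if 0 \<in> X then 1 else 0)"
    "card (X \<inter> {..0}) = card {x\<in>X. x < 0} + (if 0 \<in> X then 1 else 0)" if "finite X" for X :: "real set"
  proof -
    have "card ({x\<in>X. x > 0} \<union> (X \<inter> {0})) = card {x\<in>X. x > 0} + card (X \<inter> {0})"
      "card ({x\<in>X. x < 0} \<union> (X \<inter> {0})) = card {x\<in>X. x < 0} + card (X \<inter> {0})"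
      using that by (intro card_Un_disjoint; auto)+
    then show "card (X \<inter> {0..}) = card {x\<in>X. x > 0} + (if 0 \<in> X then 1 else 0)"
      "card (X \<inter> {..0}) = card {x\<in>X. x < 0} + (if 0 \<in> X then 1 else 0)"
      unfolding eq card0 by this+
  qed
  have ineq: "a \<le> Suc c" "c \<le> Suc a" "b \<le> Suc d" "d \<le> Suc b"
    "0 \<in> ?A \<Longrightarrow> a \<le> c" "0 \<in> ?A \<Longrightarrow> b \<le> d" 
    using jacobi_roots_interlace[where J = "{0<..}" and n = n and \<alpha> = \<alpha>] jacobi_roots_interlace[where J = "{..<0}" and n = n and \<alpha> = \<alpha>]
      jacobi_roots_interlace[where J = "{0..}" and n = n and \<alpha> = \<alpha>] jacobi_roots_interlace[where J = "{..0}" and n = n and \<alpha> = \<alpha>] W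
    unfolding half[OF fin(1)] half[OF fin(2)] eq(1,2) by (simp_all add: a_def b_def c_def d_def)
  have sgn: "sgn (\<Prod>?A * \<Prod>?B) = (if 0 \<in> ?A \<or> 0 \<in> ?B then 0 else (-1) ^ (b + d))"
    by (simp add: sgn_mult sgn_prod_reals[OF fin(1)] sgn_prod_reals[OF fin(2)] b_def d_def power_add)
  consider "0 \<in> ?A" "a = c" "b = d" | "0 \<in> ?B" "a = c + 1" "b = d + 1"
    | "0 \<notin> ?A" "0 \<notin> ?B" "a = c + 1" "b = d" | "0 \<notin> ?A" "0 \<notin> ?B" "a = c" "b = d + 1"
  proof (cases "0 \<in> ?A")
    case True
    then have "a + b = c + d" "a \<le> c" "b \<le> d" using sum W ineq by auto
    then show ?thesis using that(1) True by linarith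
  next
    case A: False
    show ?thesis
    proof (cases "0 \<in> ?B")
      case True
      then have "a + b = c + d + 2" "a \<le> Suc c" "b \<le> Suc d" using sum A ineq by auto
      then show ?thesis using that(2) True by linarith
    next
      case False
      then have "a + b = c + d + 1" using sum A by auto
      then have "a = c + 1 \<and> b = d \<or> a = c \<and> b = d + 1" using ineq(1-4) by linarith
      then show ?thesis using that(3,4) A False by blast
    qed
  qed
  then show ?thesis
    using W unfolding signature_path_tridiag sgn a_def[symmetric] b_def[symmetric] c_def[symmetric] d_def[symmetric]
    by cases auto
qed

section \<open>The Rademacher symbol of an edge path\<close>

lemma path_matrix_Nil: "path_matrix [] = S_mat"
  by (simp add: path_matrix_def)

text \<open>
  Path matrices are built by multiplication on the right, but the induction needs the left:
  multiplying by $S T^n$ on the left affects $\Phi$ in a way that is read off from the first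
  column alone.
\<close>
lemma path_matrix_Cons: "path_matrix (n # \<alpha>) = mat2 0 (-1) 1 n ** path_matrix \<alpha>"
proof (induction \<alpha> rule: rev_induct)
  case Nil
  show ?case using path_matrix_snoc[of "[]" n] by (simp add: path_matrix_Nil S_mat_def mat2_mult)
next
  case (snoc m \<alpha>)
  have "path_matrix (n # \<alpha> @ [m]) = path_matrix (n # \<alpha>) ** mat2 m (-1) 1 0"
    using path_matrix_snoc[of "n # \<alpha>" m] by simp
  then show ?case by (simp add: snoc path_matrix_snoc matrix_mul_assoc)
qed

lemma path_matrix_Cons_mat2:
  assumes "path_matrix \<alpha> = mat2 a b c d"
  shows "path_matrix (n # \<alpha>) = mat2 (- c) (- d) (a + n * c) (b + n * d)"
  by (simp add: path_matrix_Cons assms mat2_mult)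

lemma path_matrix_in_SL2: "path_matrix \<alpha> \<in> carrier SL2"
proof (induction \<alpha>)
  case Nil
  show ?case by (simp add: path_matrix_Nil S_mat_def)
next
  case (Cons n \<alpha>)
  obtain a b c d where A: "path_matrix \<alpha> = mat2 a b c d" by (rule mat2_cases)
  show ?case using Cons by (simp add: path_matrix_Cons_mat2[OF A] A algebra_simps)
qed

text \<open>
  Both sides are the continuant of the list: the lower left entry satisfies the three-term
  recursion of the polynomials at $0$, up to the alternating sign that turns the constant term
  of a characteristic polynomial into the determinant.
\<close>
lemma path_matrix_eq_prod_roots:
  "real_of_int (path_matrix \<alpha> $ 2 $ 1) = \<Prod>(jacobi_roots \<alpha>)"
proof -
  have "real_of_int (path_matrix \<alpha> $ 2 $ 1) = (-1) ^ length \<alpha> * poly (jacobi_poly \<alpha>) 0"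
  proof (induction \<alpha> rule: jacobi_poly.induct)
    case (3 n m \<alpha>)
    obtain a b c d where A: "path_matrix \<alpha> = mat2 a b c d" by (rule mat2_cases)
    note B = path_matrix_Cons_mat2[OF A, of m]
    have 1: "real_of_int (a + m * c) = - ((-1) ^ length \<alpha> * poly (jacobi_poly (m # \<alpha>)) 0)"
      using 3 by (simp add: B)
    have 2: "real_of_int c = (-1) ^ length \<alpha> * poly (jacobi_poly \<alpha>) 0" using 3 by (simp add: A)
    have "real_of_int (path_matrix (n # m # \<alpha>) $ 2 $ 1) = of_int n * of_int (a + m * c) - of_int c"
      by (simp add: path_matrix_Cons_mat2[OF B])
    then show ?case unfolding 1 2 by (simp add: algebra_simps)
  qed (simp_all add: path_matrix_Cons path_matrix_Nil S_mat_def mat2_mult)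
  also have "poly (jacobi_poly \<alpha>) 0 = (\<Prod>x\<in>jacobi_roots \<alpha>. - x)"
    by (subst jacobi_poly_eq_prod_roots) (simp add: poly_prod)
  also have "\<dots> = (-1) ^ length \<alpha> * \<Prod>(jacobi_roots \<alpha>)"
    by (simp add: prod_uminus card_jacobi_roots)
  also have "(-1) ^ length \<alpha> * ((-1) ^ length \<alpha> * \<Prod>(jacobi_roots \<alpha>)) = \<Prod>(jacobi_roots \<alpha>)"
    by (simp flip: power_mult_distrib mult.assoc)
  finally show ?thesis .
qed

lemma trace_path_tridiag: "mat_trace (path_tridiag \<alpha>) = real_of_int (sum_list \<alpha>)"
proof -
  have "mat_trace (path_tridiag \<alpha>) = (\<Sum>i<length \<alpha>. real_of_int (\<alpha> ! i))"
    by (simp add: mat_trace_def path_tridiag_def)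
  also have "\<dots> = real_of_int (sum_list \<alpha>)"
    by (simp add: sum_list_sum_nth atLeast0LessThan)
  finally show ?thesis .
qed

lemma signature_path_tridiag_Nil: "signature (path_tridiag []) = 0"
  by (simp add: signature_path_tridiag jacobi_roots_def)

text \<open>
  Putting $n$ in front of the list changes both sides by $n - 3\,\mathrm{sgn}(c c')$, where $c$
  and $c'$ are the lower left entries of the path matrices, that is, the determinants of the
  tridiagonal matrices.
\<close>
lemma rademacher_path_matrix:
  "rademacher (path_matrix \<alpha>) = mat_trace (path_tridiag \<alpha>) - 3 * of_int (signature (path_tridiag \<alpha>))"
proof (induction \<alpha>)
  case Nil
  have "dedekind_sum 0 1 = 0" by (rule dedekind_sum_1_right)
  then show ?case
    by (simp add: path_matrix_Nil S_mat_def rademacher_mat2 trace_path_tridiag signature_path_tridiag_Nil)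
next
  case (Cons n \<alpha>)
  obtain a b c d where A: "path_matrix \<alpha> = mat2 a b c d" by (rule mat2_cases)
  have det: "a * d - b * c = 1" using path_matrix_in_SL2[of \<alpha>] by (simp add: A)
  then have det': "(a + n * c) * d - (b + n * d) * c = 1" by (simp add: algebra_simps)
  have prods: "\<Prod>(jacobi_roots (n # \<alpha>)) = of_int (a + n * c)" "\<Prod>(jacobi_roots \<alpha>) = of_int c"
    using path_matrix_eq_prod_roots[of "n # \<alpha>"] path_matrix_eq_prod_roots[of \<alpha>]
    by (simp_all add: path_matrix_Cons_mat2[OF A] A)
  have sgn: "sgn (real_of_int x) = of_int (sgn x)" for x by (simp add: sgn_if)
  have "real_of_int (signature (path_tridiag (n # \<alpha>))) = of_int (signature (path_tridiag \<alpha>))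
     + of_int (sgn ((a + n * c) * c))"
    unfolding signature_path_tridiag_Cons prods of_int_mult[symmetric] sgn ..
  moreover have "rademacher (path_matrix (n # \<alpha>)) = rademacher (path_matrix \<alpha>) + n - 3 * of_int (sgn ((a + n * c) * c))"
    unfolding path_matrix_Cons_mat2[OF A] rademacher_S_mult[OF det'] A
    by (simp add: rademacher_T_mult[OF det])
  ultimately show ?case using Cons by (simp add: trace_path_tridiag)
qed

lemma rademacher_of_edge_path:
  assumes "PSL2_eq A (real_mat (path_matrix \<alpha>))"
  shows "rademacher (int_mat A) = mat_trace (path_tridiag \<alpha>) - 3 * of_int (signature (path_tridiag \<alpha>))"
proof -
  have "int_mat (real_mat P) = P" "int_mat (- real_mat P) = - P" for P
    by (rule mat2_eqI; simp flip: of_int_minus)+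
  then have "int_mat A = path_matrix \<alpha> \<or> int_mat A = - path_matrix \<alpha>"
    using assms by (auto simp: PSL2_eq_def)
  then show ?thesis using rademacher_path_matrix[of \<alpha>] by (auto simp: rademacher_uminus)
qed

section \<open>The normalizer of $\Gamma_0(p)$\<close>

lemma of_int_divide_in_Ints_iff: "p > 0 \<Longrightarrow> real_of_int x / real_of_int p \<in> \<int> \<longleftrightarrow> p dvd x"
proof
  assume p: "p > 0" and "real_of_int x / real_of_int p \<in> \<int>"
  then obtain y where "real_of_int x / real_of_int p = of_int y" by (auto elim: Ints_cases)
  then have "real_of_int x = of_int (p * y)" using p by (simp add: field_simps)
  then have "x = p * y" by (simp only: of_int_eq_iff)
  then show "p dvd x" by simp
qed auto

lemma mat2_in_Gamma0_iff:
  assumes "p > 0" "a * d - b * c = 1"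
  shows "mat2 a b c d \<in> Gamma0 p \<longleftrightarrow> a \<in> \<int> \<and> b \<in> \<int> \<and> c / real p \<in> \<int> \<and> d \<in> \<int>"
proof
  assume "mat2 a b c d \<in> Gamma0 p"
  then obtain M :: "int^2^2" where M: "mat2 a b c d = real_mat M" "int p dvd M $ 2 $ 1"
    by (auto simp: Gamma0_def)
  have "mat2 a b c d $ i $ j = real_mat M $ i $ j" for i j using M(1) by simp
  from this[of 1 1] this[of 1 2] this[of 2 1] this[of 2 2]
  have "a = of_int (M $ 1 $ 1)" "b = of_int (M $ 1 $ 2)" "c = of_int (M $ 2 $ 1)" "d = of_int (M $ 2 $ 2)"
    by simp_all
  moreover have "real_of_int (M $ 2 $ 1) / real p \<in> \<int>"
    using M(2) of_int_divide_in_Ints_iff[of "int p" "M $ 2 $ 1"] assms(1) by simp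
  ultimately show "a \<in> \<int> \<and> b \<in> \<int> \<and> c / real p \<in> \<int> \<and> d \<in> \<int>" by simp
next
  assume "a \<in> \<int> \<and> b \<in> \<int> \<and> c / real p \<in> \<int> \<and> d \<in> \<int>"
  then obtain x y z w where *: "a = of_int x" "b = of_int y" "c / real p = of_int z" "d = of_int w"
    by (auto elim!: Ints_cases)
  then have c: "c = of_int (int p * z)" using assms(1) by (simp add: field_simps)
  have "real_of_int (x * w - y * (int p * z)) = of_int 1" using assms(2) * c by simp
  then have "x * w - y * (int p * z) = 1" by (simp only: of_int_eq_iff)
  moreover have "mat2 a b c d = real_mat (mat2 x y (int p * z) w)"
    by (rule mat2_eqI) (simp_all add: * c)
  ultimately show "mat2 a b c d \<in> Gamma0 p"
    unfolding Gamma0_def by (intro image_eqI[where x = "mat2 x y (int p * z) w"]) simp_all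
qed

lemma Gamma0_subset_SL2: "Gamma0 p \<subseteq> carrier SL2"
proof
  fix A assume "A \<in> Gamma0 p"
  then obtain M :: "int^2^2" where M: "A = real_mat M" "M \<in> carrier SL2" by (auto simp: Gamma0_def)
  obtain a b c d where [simp]: "M = mat2 a b c d" by (rule mat2_cases)
  have "A = mat2 (of_int a) (of_int b) (of_int c) (of_int d)"
    by (rule mat2_eqI) (simp_all add: M)
  moreover have "real_of_int a * of_int d - of_int b * of_int c = 1"
    using M(2) by simp (metis of_int_1 of_int_diff of_int_mult)
  ultimately show "A \<in> carrier SL2" by simp
qed

lemma Gamma0_plus_subset_SL2: "Gamma0_plus p \<subseteq> carrier SL2"
  by (auto simp: Gamma0_plus_def normalizer_def stabilizer_def)

lemma Gamma0_plus_conjugate: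
  assumes \<gamma>: "mat2 a b c d \<in> Gamma0_plus p" and M: "mat2 x y z w \<in> Gamma0 p"
  shows "mat2 a b c d ** mat2 x y z w ** mat2 d (- b) (- c) a \<in> Gamma0 p"
proof -
  interpret group "SL2 :: (real^2^2) monoid" by (rule group_SL2)
  have det: "a * d - b * c = 1" using \<gamma> Gamma0_plus_subset_SL2[of p] by auto
  have inv: "inv\<^bsub>SL2\<^esub> (mat2 a b c d) = mat2 d (- b) (- c) a"
    using det by (intro inv_equality) (simp_all add: mult.commute, simp add: SL2_def mat2_mult mat2_one algebra_simps)
  have "mat2 a b c d <#\<^bsub>SL2\<^esub> Gamma0 p #>\<^bsub>SL2\<^esub> inv\<^bsub>SL2\<^esub> (mat2 a b c d) = Gamma0 p"
    using \<gamma> Gamma0_subset_SL2[of p] by (simp add: Gamma0_plus_def normalizer_def stabilizer_def)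
  moreover have "mat2 a b c d \<otimes>\<^bsub>SL2\<^esub> mat2 x y z w \<otimes>\<^bsub>SL2\<^esub> inv\<^bsub>SL2\<^esub> (mat2 a b c d)
      \<in> mat2 a b c d <#\<^bsub>SL2\<^esub> Gamma0 p #>\<^bsub>SL2\<^esub> inv\<^bsub>SL2\<^esub> (mat2 a b c d)"
    using M by (auto simp: l_coset_def r_coset_def)
  ultimately show ?thesis unfolding inv by (simp add: SL2_def)
qed

text \<open>
  If $p x$ is an integer and $p$ divides its square $p \cdot (p x^2)$, then $p$ divides it.
\<close>
lemma Ints_if_prime_multiple:
  fixes x :: real
  assumes "prime p" "real p * x \<in> \<int>" "real p * x\<^sup>2 \<in> \<int>"
  shows "x \<in> \<int>"
proof -
  have p: "prime (int p)" "p > 0" using assms(1) prime_gt_0_nat by auto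
  obtain u v where u: "real p * x = of_int u" and v: "real p * x\<^sup>2 = of_int v"
    using assms(2,3) by (auto elim!: Ints_cases)
  have "real_of_int (u\<^sup>2) = (real p * x)\<^sup>2" by (simp add: u)
  also have "\<dots> = real p * (real p * x\<^sup>2)" by (simp add: power2_eq_square)
  also have "\<dots> = of_int (int p * v)" by (simp add: v)
  finally have "u\<^sup>2 = int p * v" by (simp only: of_int_eq_iff)
  then have "int p dvd u\<^sup>2" by simp
  then have "int p dvd u" using p(1) prime_dvd_power by blast
  then obtain w where "u = int p * w" by blast
  then have "x = of_int w" using u p(2) by simp
  then show ?thesis by simp
qed

lemma primitive_decomposition:
  fixes A n m x :: int
  assumes "A > 0"
  obtains g A' n' m' x' where "g > 0" "A = g * A'" "n = g * n'" "m = g * m'" "x = g * x'"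
    "\<forall>q. q dvd A' \<and> q dvd n' \<and> q dvd m' \<and> q dvd x' \<longrightarrow> is_unit q"
proof -
  define g where "g = gcd (gcd A n) (gcd m x)"
  have g: "g > 0" using assms by (simp add: g_def)
  have "g dvd A" "g dvd n" "g dvd m" "g dvd x"
    unfolding g_def by (auto intro: dvd_trans gcd_dvd1 gcd_dvd2)
  then obtain A' n' m' x' where *: "A = g * A'" "n = g * n'" "m = g * m'" "x = g * x'"
    by (auto elim!: dvdE)
  have "is_unit q" if "q dvd A'" "q dvd n'" "q dvd m'" "q dvd x'" for q
  proof -
    have "g * q dvd g" using that unfolding g_def[symmetric] by (subst (2) g_def) (simp add: *)
    then show ?thesis using g by simp
  qed
  then show ?thesis using that[OF g *] by blast
qed

lemma one_or_prime_if_prime_factors: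
  fixes e p :: int
  assumes "e > 0" and "prime p" and "\<And>q. prime q \<Longrightarrow> q dvd e \<Longrightarrow> q = p" and "\<not> p\<^sup>2 dvd e"
  shows "e = 1 \<or> e = p"
proof (cases "e = 1")
  case False
  have prime_factor: "\<exists>q. prime q \<and> q dvd f" if "f > 0" "f \<noteq> 1" for f :: int
    using that prime_divisor_exists[of f] by auto
  then obtain q where "prime q" "q dvd e" using assms(1) False by blast
  then obtain f where f: "e = p * f" using assms(3) by (auto elim: dvdE)
  have "f = 1"
  proof (rule ccontr)
    assume "f \<noteq> 1"
    moreover have "f > 0" using f assms(1) prime_gt_0_int[OF assms(2)] by (simp add: zero_less_mult_iff)
    ultimately obtain r where "prime r" "r dvd f" using prime_factor by blast
    then have "p dvd f" using assms(3)[of r] f by auto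
    then show False using assms(4) f by (simp add: power2_eq_square)
  qed
  then show ?thesis using f by simp
qed simp

lemma fricke_in_Gamma0_if:
  assumes p: "p > 0" and det: "a * d - b * c = 1"
    and "c / sqrt p \<in> \<int>" "d / sqrt p \<in> \<int>" "a / sqrt p \<in> \<int>" "sqrt p * b \<in> \<int>"
  shows "fricke p (mat2 a b c d) \<in> Gamma0 p"
proof -
  have sq: "real p / sqrt p = sqrt p" "sqrt p * sqrt p = real p" "sqrt p \<noteq> 0"
    using p by (simp_all add: real_div_sqrt)
  have cancel: "real p * y / sqrt p = sqrt p * y" for y
  proof -
    have "real p * y / sqrt p = (real p / sqrt p) * y" by simp
    then show ?thesis by (simp only: sq(1))
  qed
  have "fricke p (mat2 a b c d) = mat2 (c / sqrt p) (d / sqrt p) (- (sqrt p * a)) (- (sqrt p * b))"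
    by (rule mat2_eqI) (simp_all add: fricke_def cancel)
  moreover have "c / sqrt p * (- (sqrt p * b)) - d / sqrt p * (- (sqrt p * a)) = 1"
    using det sq(3) by (simp add: algebra_simps)
  moreover have "- (sqrt p * a) / real p = - (a / sqrt p)"
    using sq p by (simp add: field_simps)
  ultimately show ?thesis
    using assms by (simp add: mat2_in_Gamma0_iff)
qed

text \<open>
  Conjugates of three elements of $\Gamma_0(p)$ are inspected: the unipotent matrices with rows
  $(1,1)$, $(0,1)$ and $(1,0)$, $(p,1)$, and their product. The entries of the first two
  conjugates are, up to factors $p$ and the summand $1$, squares and products of the entries of
  $\gamma$; the mixed products in the third are integral only after multiplication by $p$, but
  their squares are controlled by the first two.
\<close>
lemma Gamma0_plus_integrality:
  assumes p: "prime p" and \<gamma>: "mat2 a b c d \<in> Gamma0_plus p"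
  shows "a\<^sup>2 \<in> \<int>" "d\<^sup>2 \<in> \<int>" "c\<^sup>2 / real p \<in> \<int>" "real p * b\<^sup>2 \<in> \<int>"
    "a * c \<in> \<int>" "a * b \<in> \<int>" "a * d \<in> \<int>" "b * d \<in> \<int>"
proof -
  have p0: "p > 0" using p prime_gt_0_nat by auto
  have det: "a * d - b * c = 1" using \<gamma> Gamma0_plus_subset_SL2[of p] by auto
  have conj: "(a*x + b*z)*d - (a*y + b*w)*c \<in> \<int> \<and> (a*y + b*w)*a - (a*x + b*z)*b \<in> \<int> \<and>
      ((c*x + d*z)*d - (c*y + d*w)*c) / real p \<in> \<int>"
    if "x * w - y * z = 1" "x \<in> \<int>" "y \<in> \<int>" "z / real p \<in> \<int>" "w \<in> \<int>" for x y z w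
  proof -
    have "mat2 x y z w \<in> Gamma0 p" using that p0 by (simp add: mat2_in_Gamma0_iff)
    from Gamma0_plus_conjugate[OF \<gamma> this]
    have M: "mat2 ((a*x + b*z)*d - (a*y + b*w)*c) ((a*y + b*w)*a - (a*x + b*z)*b)
       ((c*x + d*z)*d - (c*y + d*w)*c) ((c*y + d*w)*a - (c*x + d*z)*b) \<in> Gamma0 p" (is "mat2 ?A ?B ?C ?D \<in> _")
      by (simp add: mat2_mult algebra_simps)
    then have "?A * ?D - ?B * ?C = 1" using Gamma0_subset_SL2[of p] by auto
    then show ?thesis using M p0 by (simp add: mat2_in_Gamma0_iff)
  qed
  have T: "- (a * c) + 1 \<in> \<int>" "a\<^sup>2 \<in> \<int>" "- (c\<^sup>2 / real p) \<in> \<int>"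
    using conj[of 1 1 1 0] det by (simp_all add: algebra_simps power2_eq_square)
  have V: "1 + real p * (b * d) \<in> \<int>" "- (real p * b\<^sup>2) \<in> \<int>" "d\<^sup>2 \<in> \<int>"
    using conj[of 1 1 0 "real p"] det p0 by (simp_all add: algebra_simps power2_eq_square)
  have "(a*(1 + real p) + b*real p)*d - (a*1 + b*1)*c = (a * d - b * c) + real p * (a * d) + real p * (b * d) - a * c"
    "(a*1 + b*1)*a - (a*(1 + real p) + b*real p)*b = a\<^sup>2 - real p * (a * b) - real p * b\<^sup>2"
    by (simp_all add: algebra_simps power2_eq_square)
  then have U: "1 + real p * (a * d) + real p * (b * d) - a * c \<in> \<int>" "a\<^sup>2 - real p * (a * b) - real p * b\<^sup>2 \<in> \<int>"
    using conj[of "1 + real p" 1 1 "real p"] p0 by (simp_all only: det) simp_all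
  show a2: "a\<^sup>2 \<in> \<int>" and d2: "d\<^sup>2 \<in> \<int>" using T V by auto
  show "c\<^sup>2 / real p \<in> \<int>" using T(3) minus_in_Ints_iff by blast
  show b2: "real p * b\<^sup>2 \<in> \<int>" using V(2) minus_in_Ints_iff by blast
  have "(1::real) - (- (a * c) + 1) \<in> \<int>" using T(1) by (intro Ints_diff Ints_1)
  then show ac: "a * c \<in> \<int>" by simp
  have "1 + real p * (b * d) - 1 \<in> \<int>" using V(1) by (intro Ints_diff Ints_1)
  then have pbd: "real p * (b * d) \<in> \<int>" by simp
  have "real p * (a * d) = (1 + real p * (a * d) + real p * (b * d) - a * c) - 1 - real p * (b * d) + a * c"
    by simp
  also have "\<dots> \<in> \<int>"
    by (rule Ints_add[OF Ints_diff[OF Ints_diff[OF U(1) Ints_1] pbd] ac])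
  finally have pad: "real p * (a * d) \<in> \<int>" .
  have "real p * (a * b) = a\<^sup>2 - real p * b\<^sup>2 - (a\<^sup>2 - real p * (a * b) - real p * b\<^sup>2)"
    by simp
  also have "\<dots> \<in> \<int>"
    by (rule Ints_diff[OF Ints_diff[OF a2 b2] U(2)])
  finally have pab: "real p * (a * b) \<in> \<int>" .
  have "a\<^sup>2 * (real p * b\<^sup>2) \<in> \<int>" using a2 b2 by (rule Ints_mult)
  then show "a * b \<in> \<int>" by (intro Ints_if_prime_multiple[OF p pab]) (simp add: power_mult_distrib mult_ac)
  have "real p * (a\<^sup>2 * d\<^sup>2) \<in> \<int>" using a2 d2 by (intro Ints_mult) auto
  then show "a * d \<in> \<int>" by (intro Ints_if_prime_multiple[OF p pad]) (simp add: power_mult_distrib mult_ac)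
  have "(real p * b\<^sup>2) * d\<^sup>2 \<in> \<int>" using b2 d2 by (rule Ints_mult)
  then show "b * d \<in> \<int>" by (intro Ints_if_prime_multiple[OF p pbd]) (simp add: power_mult_distrib mult_ac)
qed

text \<open>
  For $a \neq 0$ multiplication by $a$ turns the matrix into an integral one, and dividing by
  the content $g$ gives a primitive integral matrix with determinant $e$, so that $\gamma$ is
  this matrix divided by $s = a/g$ with $s^2 = e$. A prime $q \neq p$ dividing $e$, or the
  square of $p$ dividing $e$, would by integrality of $a^2$, $p b^2$, $c^2/p$, $d^2$ divide all
  entries of the primitive matrix (in the second case, $p$ itself would do so). Hence $e = 1$,
  which means $\gamma \in \Gamma_0(p)$, or $e = p$, which means that the Fricke translate is in
  $\Gamma_0(p)$. For $a = 0$ the entries are $c = \pm\sqrt p$ and $b = -1/c$.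
\<close>
lemma Gamma0_plus_cases:
  assumes p: "prime p" and \<gamma>: "mat2 a b c d \<in> Gamma0_plus p"
  shows "mat2 a b c d \<in> Gamma0 p \<or> fricke p (mat2 a b c d) \<in> Gamma0 p"
proof -
  note int = Gamma0_plus_integrality[OF p \<gamma>]
  have p0: "p > 0" and pp: "prime (int p)" using p prime_gt_0_nat by auto
  have sp: "sqrt p \<noteq> 0" "sqrt p * sqrt p = real p" using p0 by simp_all
  have det: "a * d - b * c = 1" using \<gamma> Gamma0_plus_subset_SL2[of p] by auto
  show ?thesis
  proof (cases "a = 0")
    case True
    then have bc: "b * c = -1" using det by simp
    obtain B C where B: "real p * b\<^sup>2 = of_int B" and C: "c\<^sup>2 / real p = of_int C"
      using int(3,4) by (auto elim!: Ints_cases)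
    have "real_of_int (B * C) = (b * c)\<^sup>2"
      unfolding of_int_mult B[symmetric] C[symmetric] using p0 by (simp add: power_mult_distrib)
    then have "real_of_int (B * C) = of_int 1" using bc by simp
    then have "B * C = 1" by (simp only: of_int_eq_iff)
    moreover have "C \<ge> 0"
    proof -
      have "real_of_int C \<ge> 0" unfolding C[symmetric] by simp
      then show ?thesis by simp
    qed
    ultimately have "C = 1" by (auto simp: zmult_eq_1_iff)
    then have "(c / sqrt p)\<^sup>2 = 1" by (simp add: power_divide C)
    then have c: "c / sqrt p = 1 \<or> c / sqrt p = -1" by (simp add: power2_eq_1_iff)
    then have "c / sqrt p \<in> \<int>" by auto
    moreover have "sqrt p * b \<in> \<int>"
    proof -
      have "(sqrt p * b) * (c / sqrt p) = -1" using bc sp by simp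
      moreover have "v = 1 \<or> v = -1" if "v * u = -1" "u = 1 \<or> u = -1" for u v :: real
        using that by auto
      ultimately have "sqrt p * b = 1 \<or> sqrt p * b = -1" using c by blast
      then show ?thesis by auto
    qed
    moreover have "d / sqrt p = - ((b * d) * (c / sqrt p))"
    proof -
      have "(b * d) * (c / sqrt p) = (b * c) * d / sqrt p" by simp
      then show ?thesis using bc by simp
    qed
    then have "d / sqrt p \<in> \<int>" 
      using Ints_minus[OF Ints_mult[OF int(8) \<open>c / sqrt p \<in> \<int>\<close>]] by (simp only:)
    ultimately show ?thesis using True p0 det by (intro disjI2 fricke_in_Gamma0_if) auto
  next
    case False
    obtain A n m x where A: "a\<^sup>2 = of_int A" and n: "a * b = of_int n" and m: "a * c = of_int m"
      and x: "a * d = of_int x" using int by (auto elim!: Ints_cases)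
    have "real_of_int A > 0" using False unfolding A[symmetric] by simp
    then have "A > 0" by simp
    then obtain g A' n' m' x' where g: "g > 0" and eqs: "A = g * A'" "n = g * n'" "m = g * m'" "x = g * x'"
      and prim: "\<forall>q. q dvd A' \<and> q dvd n' \<and> q dvd m' \<and> q dvd x' \<longrightarrow> is_unit q"
      by (rule primitive_decomposition[where n = n and m = m and x = x])
    define e where "e = A' * x' - n' * m'"
    define s where "s = a / of_int g"
    have s0: "s \<noteq> 0" using False g by (simp add: s_def)
    have entries: "a = of_int A' / s" "b = of_int n' / s" "c = of_int m' / s" "d = of_int x' / s"
      using False g A n m x unfolding s_def eqs by (simp_all add: field_simps power2_eq_square)
    have s2: "s\<^sup>2 = of_int e"
    proof -
      have "of_int e = (s * a) * (s * d) - (s * b) * (s * c)"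
        using s0 by (simp add: e_def entries)
      also have "\<dots> = s\<^sup>2 * (a * d - b * c)" by (simp add: power2_eq_square algebra_simps)
      finally show ?thesis using det by simp
    qed
    have e0: "e > 0"
    proof -
      have "real_of_int e > 0" unfolding s2[symmetric] using s0 by simp
      then show ?thesis by simp
    qed
    \<comment> \<open>Hence every divisor of $e$ divides the first entry of the primitive matrix.\<close>
    have A': "A' = g * e"
    proof -
      have "a = s * of_int g" using g by (simp add: s_def)
      then have "of_int A' = s\<^sup>2 * of_int g" using entries(1) s0 by (simp add: field_simps power2_eq_square)
      then have "real_of_int A' = of_int (g * e)" by (simp add: s2)
      then show ?thesis by (simp only: of_int_eq_iff)
    qed
    have dvd_x: "e dvd x'\<^sup>2"
    proof -
      have "real_of_int (x'\<^sup>2) / of_int e \<in> \<int>" using int(2) unfolding entries(4) power_divide s2 by simp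
      then show ?thesis using e0 by (simp only: of_int_divide_in_Ints_iff)
    qed
    have dvd_n: "e dvd int p * n'\<^sup>2"
    proof -
      have "real_of_int (int p * n'\<^sup>2) / of_int e \<in> \<int>" using int(4) unfolding entries(2) power_divide s2 by simp
      then show ?thesis using e0 by (simp only: of_int_divide_in_Ints_iff)
    qed
    have dvd_m: "int p * e dvd m'\<^sup>2"
    proof -
      have "real_of_int (m'\<^sup>2) / of_int (int p * e) \<in> \<int>"
        using int(3) unfolding entries(3) power_divide s2 by (simp add: mult.commute)
      moreover have "int p * e > 0" using e0 p0 by simp
      ultimately show ?thesis by (simp only: of_int_divide_in_Ints_iff)
    qed
    have p_m: "int p dvd m'" using dvd_m pp by (meson dvd_mult_left prime_dvd_power)
    have "e = 1 \<or> e = int p"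
    proof (rule one_or_prime_if_prime_factors[OF e0 pp])
      fix q assume q: "prime q" "q dvd e"
      show "q = int p"
      proof (rule ccontr)
        assume "q \<noteq> int p"
        then have "\<not> q dvd int p" using q(1) pp by (metis primes_dvd_imp_eq)
        then have "q dvd n'" using q dvd_n by (meson dvd_trans prime_dvd_mult_iff prime_dvd_power)
        moreover have "q dvd x'" using q dvd_x by (meson dvd_trans prime_dvd_power)
        moreover have "q dvd m'" using q dvd_m by (meson dvd_trans dvd_mult_right prime_dvd_power)
        moreover have "q dvd A'" using q A' by simp
        ultimately have "is_unit q" using prim by blast
        then show False using q(1) not_prime_unit by blast
      qed
    next
      show "\<not> (int p)\<^sup>2 dvd e"
      proof
        assume p2: "(int p)\<^sup>2 dvd e"
        then have pe: "int p dvd e" by (meson dvd_power dvd_trans pos2)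
        have "(int p)\<^sup>2 dvd int p * n'\<^sup>2" using p2 dvd_n by (rule dvd_trans)
        then have "int p dvd n'\<^sup>2" using p0 by (simp add: power2_eq_square)
        then have "int p dvd n'" using pp prime_dvd_power by blast
        moreover have "int p dvd x'" using pe dvd_x pp by (meson dvd_trans prime_dvd_power)
        moreover have "int p dvd A'" using pe A' by simp
        ultimately have "is_unit (int p)" using prim p_m by blast
        then show False using pp not_prime_unit by blast
      qed
    qed
    then show ?thesis
    proof
      assume "e = 1"
      then have "s = 1 \<or> s = -1" using s2 by (simp add: power2_eq_1_iff)
      moreover have "real_of_int m' / real p \<in> \<int>" using p_m p0 of_int_divide_in_Ints_iff[of "int p" m'] by simp
      ultimately have "a \<in> \<int> \<and> b \<in> \<int> \<and> c / real p \<in> \<int> \<and> d \<in> \<int>"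
        unfolding entries by auto
      then show ?thesis using mat2_in_Gamma0_iff[OF p0 det] by blast
    next
      assume e: "e = int p"
      \<comment> \<open>As $s = \pm\sqrt p$, this is the sign of $s$.\<close>
      define t where "t = sqrt p / s"
      have "t\<^sup>2 = 1" using s2 e p0 by (simp add: t_def power_divide)
      then have t: "t = 1 \<or> t = -1" by (simp add: power2_eq_1_iff)
      have over: "of_int y / s / sqrt p \<in> \<int>" if "int p dvd y" for y
      proof -
        have "of_int y / s / sqrt p = t * (real_of_int y / real p)"
          using sp s0 p0 by (simp add: t_def field_simps)
        moreover have "real_of_int y / real p \<in> \<int>" using that p0 of_int_divide_in_Ints_iff[of "int p" y] by simp
        ultimately show ?thesis using t by auto
      qed
      have "int p dvd x'" using dvd_x pp e by (meson prime_dvd_power)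
      moreover have "sqrt p * b \<in> \<int>"
      proof -
        have "sqrt p * b = t * of_int n'" by (simp add: entries t_def)
        then show ?thesis using t by auto
      qed
      moreover have "int p dvd A'" using A' e by simp
      ultimately have "fricke p (mat2 a b c d) \<in> Gamma0 p"
        using p_m by (intro fricke_in_Gamma0_if[OF p0 det]) (simp_all only: entries over)
      then show ?thesis ..
    qed
  qed
qed

section \<open>The formula on $\Gamma_0^+(p)$\<close>

theorem theorem2:
  fixes p :: nat and a b c d :: real and \<gamma> :: "real^2^2" and \<alpha> \<beta> :: "int list"
  assumes "prime p" and "odd p"
    and "\<gamma> = mat2 a b c d" and "\<gamma> \<in> Gamma0_plus p"
    and "\<gamma> \<in> Gamma0 p \<Longrightarrow> PSL2_eq (mat2 a b c d) (real_mat (path_matrix \<alpha>))"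
    and "\<gamma> \<in> Gamma0 p \<Longrightarrow> PSL2_eq (mat2 a (of_nat p * b) (c / of_nat p) d) (real_mat (path_matrix \<beta>))"
  shows "rademacher_plus p \<gamma> =
    (if \<gamma> \<in> Gamma0 p then
       (mat_trace (path_tridiag \<alpha>) + mat_trace (path_tridiag \<beta>)) / 2
         - 3 * (of_int (signature (path_tridiag \<alpha>) + signature (path_tridiag \<beta>)) / 2)
     else
       rademacher_plus p ((1 / sqrt (of_nat p)) *\<^sub>R mat2 c d (- of_nat p * a) (- of_nat p * b))
         - 3 * sgn (- (a * c)))"
proof (cases "\<gamma> \<in> Gamma0 p")
  case True
  have "level_conj p \<gamma> = mat2 a (of_nat p * b) (c / of_nat p) d"
    by (simp add: level_conj_def assms(3))
  then have "rademacher_plus p \<gamma> = (rademacher (int_mat (mat2 a b c d))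
      + rademacher (int_mat (mat2 a (of_nat p * b) (c / of_nat p) d))) / 2"
    using True by (simp add: rademacher_plus_def rademacher_Gamma0_def assms(3))
  then show ?thesis
    using True assms(5,6)[OF True, THEN rademacher_of_edge_path] by (simp add: field_simps)
next
  case False
  have "fricke p \<gamma> = (1 / sqrt (of_nat p)) *\<^sub>R mat2 c d (- of_nat p * a) (- of_nat p * b)"
    by (simp add: fricke_def assms(3))
  moreover have "fricke p \<gamma> \<in> Gamma0 p"
    using Gamma0_plus_cases[of p a b c d] assms(1,3,4) False by auto
  ultimately show ?thesis using False by (simp add: rademacher_plus_def assms(3))
qed

end
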